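(* Let $p\ge 3$, let $\mathcal M_1,\mathcal M_2\subset\mathcal E$ be $C^{p,1}$ embedded submanifolds, $\mathcal M=\mathcal M_1\cap\mathcal M_2$, fix $\bar x\in\mathcal M$, and let $\Omega_{\bar x}\subset\mathcal M$ and $K=\mathrm{cl}_{\mathcal M}\Omega_{\bar x}$ be the local sets described in the context. Suppose that, at every $x\in K$, $\mathcal M_1$ and $\mathcal M_2$ intersect cleanly, the alternating framework holds, and the decomposition property holds (all as defined in the context). Let $\rho_K>0$ be a (sufficiently small) radius and $\mathcal D_K:=\{(x,\eta)\in\mathrm T\mathcal M:\ x\in\Omega_{\bar x},\ \|\eta\|<\rho_K\}$ the domain on which the iterates $x_0=x+\eta$, $x_{k+1}=\varphi(x_k)$ are well-defined and the limit $\psi(x,\eta)=\lim_{k\to\infty}x_k$ exists and defines a first-order retraction. Then the limit map $\psi$ defines a second-order retraction on $\mathcal D_K$.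
   Context: Notation. $\mathcal E$ is a Euclidean space with norm $\|\cdot\|$; $\mathbb B(x,r)$ is the open ball. For a closed set $D$, $\mathcal P_D$ is the orthogonal projection onto $D$ (locally single-valued near a submanifold and treated as such) and $d_D(x)=\|x-\mathcal P_D(x)\|$. A map is $C^{p,1}$ if it is $p$ times continuously differentiable with locally Lipschitz $p$-th derivative; a $C^{p,1}$ embedded submanifold has $C^{p,1}$ local defining functions of full rank. $\mathrm T_x\mathcal M$ and $\mathrm N_x\mathcal M=(\mathrm T_x\mathcal M)^\perp$ are the tangent and normal spaces, and $\mathrm T\mathcal M=\{(x,\eta):x\in\mathcal M,\ \eta\in\mathrm T_x\mathcal M\}\subset\mathcal E\times\mathcal E$ is the tangent bundle. Clean intersection. $\mathcal M_1,\mathcal M_2$ intersect cleanly at $x\in\mathcal M$ if $\mathcal M$ is a $C^{p,1}$ embedded submanifold in a neighborhood of $x$ and $\mathrm T_y\mathcal M=\mathrm T_y\mathcal M_1\cap\mathrm T_y\mathcal M_2$ for all $y$ in a neighborhood of $x$ in $\mathcal M$. Alternating framework. There are an open neighborhood $\mathcal U_{\bar x}\subset\mathcal E$ of the base point and $C^{p-1}$ maps $\phi_1:\mathcal U_{\bar x}\to\mathcal M_1$, $\phi_2:\mathcal U_{\bar x}\to\mathcal E$, with $\varphi:=\phi_1\circ\phi_2$ (where defined), such that one of the following holds: (i) $\phi_1=\mathcal P_{\mathcal M_1}$ on $\mathcal U_{\bar x}$ and $\phi_2$ is first-order consistent with $\mathcal P_{\mathcal M_2}$; (ii) $\phi_2=\mathcal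 P_{\mathcal M_2}$ on $\mathcal U_{\bar x}$ and $\phi_1$ is first-order consistent with $\mathcal P_{\mathcal M_1}$; (iii) for each $i\in\{1,2\}$, $\phi_i$ is first-order consistent with $\mathcal P_{\mathcal M_i}$ and $\phi_i(\mathcal U_{\bar x})\subset\mathcal M_i$. Here $\phi_i$ is first-order consistent with $\mathcal P_{\mathcal M_i}$ if $\|\phi_i(y)-\mathcal P_{\mathcal M_i}(y)\|=o(d_{\mathcal M_i}(y))$ as $y\to x$, for $x\in\mathcal U_{\bar x}\cap\mathcal M_i$. When the framework is assumed at every $x\in K$, it is for the same maps $\phi_1,\phi_2$. Local sets. $\mathbf U_{\bar x}\subset\mathcal M$ and $\mathcal U_{\bar x}\subset\mathcal E$ are open neighborhoods of $\bar x$ such that: $\mathrm T_x\mathcal M=\mathrm T_x\mathcal M_1\cap\mathrm T_x\mathcal M_2$ for $x\in\mathbf U_{\bar x}$, and there is $c<1$ with $\|\mathcal P_{\mathrm T_x\mathcal M_1}\mathcal P_{\mathrm T_x\mathcal M_2}-\mathcal P_{\mathrm T_x\mathcal M}\|\le c$ for $x\in\mathbf U_{\bar x}$; the maps $\mathcal P_{\mathcal M_1},\mathcal P_{\mathcal M_2},\mathcal P_{\mathcal M},\phi_1,\phi_2$ are well-defined and $C^{p-1,1}$ on $\mathcal U_{\bar x}$; and there is $\kappa>0$ with $d_{\mathcal M}(x)\le\kappa\,d_{\mathcal M_2}(x)$ for $x\in\mathcal M_1\cap\mathcal U_{\bar x}$. $\Omega_{\bar x}\subset\mathbf U_{\bar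 x}\cap\mathcal U_{\bar x}$ is a neighborhood of $\bar x$ open in $\mathcal M$ whose closure $K=\mathrm{cl}_{\mathcal M}\Omega_{\bar x}$ in $\mathcal M$ is compact and contained in $\mathbf U_{\bar x}\cap\mathcal U_{\bar x}$. For $\delta>0$, $\mathcal N_\delta(K)=\{y\in\mathcal E:d_K(y)<\delta\}$. All statements are understood to hold after possibly shrinking $\Omega_{\bar x}$ and $\mathcal U_{\bar x}$ (and $\rho_K$) while keeping these inclusions. Radius $\delta_K$. $\delta_K>0$ is a radius with $\mathcal N_{\delta_K}(K)\subset\mathcal U_{\bar x}$ for which there are $\tau_K\in(0,1)$, $\rho_K\in(0,\delta_K]$ and $C_K>1$ such that: for $y\in\mathcal M_1\cap\mathcal N_{\delta_K}(K)$, $\varphi(y)$ is well-defined and $d_{\mathcal M_2}(\varphi(y))\le\tau_K d_{\mathcal M_2}(y)$; and for $x\in\Omega_{\bar x}$, $\eta\in\mathrm T_x\mathcal M$, $\|\eta\|\le\rho_K$, the iterates $x_0=x+\eta$, $x_{k+1}=\varphi(x_k)$ are well-defined, satisfy $x_0,\phi_2(x_0)\in\mathcal N_{\delta_K}(K)$, and for $k\ge1$ satisfy $x_k\in\mathcal M_1\cap\mathcal N_{\delta_K}(K)$, $\phi_2(x_k)\in\mathcal N_{\delta_K}(K)$, $\|x_k-x\|\le C_K\|\eta\|$. (Such constants exist under clean intersection and the alternating framework on $K$.) Decomposition property (case $p\ge3$). For each $i\in\{1,2\}$ there are maps $R_{\mathrm N_i},R_{\mathrm T_i}$ on $K\times\mathbb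 B(0,\delta_K)$, of class $C^{p-1}$, with $R_{\mathrm N_i}(x,u)\in\mathrm N_x\mathcal M_i$, $R_{\mathrm T_i}(x,u)\in\mathrm T_x\mathcal M_i$ and $$\phi_i(x+u)=x+\mathcal P_{\mathrm T_x\mathcal M_i}(u)+R_{\mathrm N_i}(x,u)+R_{\mathrm T_i}(x,u),\qquad x\in K,\ u\in\mathbb B(0,\delta_K).$$ For $x\in K$ and $u$ with $x+u\in\mathcal N_{\delta_K}(K)$ and $\mathcal P_{\mathrm N_x\mathcal M_i}(u)=o(\|u\|)$, one has $R_{\mathrm N_i}(x,u)=O(\|u\|^2)$ and $R_{\mathrm T_i}(x,u)=o(\|u\|^2)$ as $u\to0$, uniformly in $x\in K$; and $\varphi\in C^{2,1}$ with $\mathrm D^2\varphi$ Lipschitz on $\mathcal N_{\delta_K}(K)$. First-order retraction over $\mathcal D_K$: a $C^1$ map $\psi:\mathcal D_K\to\mathcal M$ such that every curve $c(t)=\psi(x,t\eta)$ satisfies $c(0)=x$, $c'(0)=\eta$. Second-order retraction over $\mathcal D_K$: a $C^2$ map $\psi:\mathcal D_K\to\mathcal M$ such that every curve $c(t)=\psi(x,t\eta)$ satisfies $c(t)=x+t\eta+o(t)$ and $\mathcal P_{\mathrm T_x\mathcal M}(c(t)-(x+t\eta))=o(t^2)$ as $t\to0$ (equivalently, $c(0)=x$, $c'(0)=\eta$ and zero intrinsic acceleration $c''(0)=\mathcal P_{\mathrm T_x\mathcal M}(\ddot c(0))=0$). *)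

theory Defs
  imports "HOL-Analysis.Analysis" "HOL-Library.Landau_Symbols"
begin

section \<open>Classes of differentiability\<close>

text \<open>
  Iterated Frechet derivatives, evaluated at fixed directions. On a finite-dimensional domain the
  \<open>k\<close>-th derivative is continuous (locally Lipschitz) as a multilinear map if and only if all these
  evaluations are. Both notions are meant for open sets \<open>S\<close>.
\<close>

primrec iterated_diff ::
  "(('a::euclidean_space \<Rightarrow> 'b::real_normed_vector) \<Rightarrow> bool) \<Rightarrow> nat \<Rightarrow> 'a set \<Rightarrow> ('a \<Rightarrow> 'b) \<Rightarrow> bool"
where
  "iterated_diff P 0 S f \<longleftrightarrow> P f"
| "iterated_diff P (Suc k) S f \<longleftrightarrow>
     (\<forall>x\<in>S. f differentiable (at x)) \<and>
     (\<forall>v. iterated_diff P k S (\<lambda>x. frechet_derivative f (at x) v))"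

definition locally_lipschitz_on ::
  "'a::metric_space set \<Rightarrow> ('a \<Rightarrow> 'b::metric_space) \<Rightarrow> bool" where
  "locally_lipschitz_on S f \<longleftrightarrow> (\<forall>x\<in>S. \<exists>r>0. \<exists>L. L-lipschitz_on (cball x r \<inter> S) f)"

definition Ck :: "nat \<Rightarrow> 'a::euclidean_space set \<Rightarrow> ('a \<Rightarrow> 'b::real_normed_vector) \<Rightarrow> bool" where
  "Ck k S f \<longleftrightarrow> iterated_diff (continuous_on S) k S f"

definition Ck1 :: "nat \<Rightarrow> 'a::euclidean_space set \<Rightarrow> ('a \<Rightarrow> 'b::real_normed_vector) \<Rightarrow> bool" where
  "Ck1 k S f \<longleftrightarrow> iterated_diff (locally_lipschitz_on S) k S f"

text \<open>
  Class \<open>C\<^sup>k\<close> on a set that need not be open, such as a piece of a submanifold: near each point,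
  \<open>f\<close> agrees with a \<open>C\<^sup>k\<close> map defined on an open subset of the ambient space.
\<close>

definition Ck_within ::
  "nat \<Rightarrow> 'a::euclidean_space set \<Rightarrow> ('a \<Rightarrow> 'b::real_normed_vector) \<Rightarrow> bool" where
  "Ck_within k S f \<longleftrightarrow>
     (\<forall>x\<in>S. \<exists>V g. open V \<and> x \<in> V \<and> Ck k V g \<and> (\<forall>y\<in>S \<inter> V. f y = g y))"


section \<open>Submanifolds, tangent and normal spaces\<close>

text \<open>
  The local defining function takes its values in a linear subspace \<open>F\<close> of the ambient space, whose
  dimension is the local codimension; this avoids quantifying over a codomain type.
  Full rank means that the derivative is onto \<open>F\<close>.
\<close>

definition embedded_submanifold :: "nat \<Rightarrow> 'a::euclidean_space set \<Rightarrow> bool" where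
  "embedded_submanifold p M \<longleftrightarrow>
     (\<forall>x\<in>M. \<exists>V F (h :: 'a \<Rightarrow> 'a).
        open V \<and> x \<in> V \<and> subspace F \<and> h ` V \<subseteq> F \<and> Ck1 p V h \<and>
        M \<inter> V = {y\<in>V. h y = 0} \<and>
        (\<forall>y\<in>M \<inter> V. range (frechet_derivative h (at y)) = F))"

definition tangent_space :: "'a::euclidean_space set \<Rightarrow> 'a \<Rightarrow> 'a set" where
  "tangent_space M x =
     {v. \<exists>e>0. \<exists>c. Ck 1 {-e<..<e::real} c \<and> c ` {-e<..<e} \<subseteq> M \<and> c 0 = x \<and>
           (c has_vector_derivative v) (at 0)}"

definition normal_space :: "'a::euclidean_space set \<Rightarrow> 'a \<Rightarrow> 'a set" where
  "normal_space M x = orthogonal_comp (tangent_space M x)"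

definition tangent_bundle :: "'a::euclidean_space set \<Rightarrow> ('a \<times> 'a) set" where
  "tangent_bundle M = {(x, \<eta>). x \<in> M \<and> \<eta> \<in> tangent_space M x}"


section \<open>Projections and distances\<close>

text \<open>
  The projection onto \<open>D\<close> is \<^const>\<open>closest_point\<close>, which is meaningful where a nearest point exists.
  The distance to \<open>D\<close> is \<^const>\<open>infdist\<close>; it is the norm of the residual of the projection
  wherever the latter is defined.
\<close>

definition projection_defined_on :: "'a::euclidean_space set \<Rightarrow> 'a set \<Rightarrow> bool" where
  "projection_defined_on U D \<longleftrightarrow> (\<forall>y\<in>U. \<exists>!z. z \<in> D \<and> (\<forall>w\<in>D. dist y z \<le> dist y w))"

lemma norm_diff_closest_point_eq_infdist:
  fixes D :: "'a::euclidean_space set"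
  assumes "z \<in> D" and "\<forall>w\<in>D. dist y z \<le> dist y w"
  shows "norm (y - closest_point D y) = infdist y D"
proof -
  have cp: "closest_point D y \<in> D \<and> (\<forall>w\<in>D. dist y (closest_point D y) \<le> dist y w)"
    unfolding closest_point_def by (rule someI[of _ z]) (use assms in blast)
  have ne: "D \<noteq> {}"
    using assms(1) by blast
  have "infdist y D \<le> dist y (closest_point D y)"
    using cp by (simp add: infdist_le)
  moreover have "dist y (closest_point D y) \<le> infdist y D"
    unfolding infdist_notempty[OF ne] by (rule cINF_greatest) (use cp ne in auto)
  ultimately show ?thesis
    by (simp add: dist_norm)
qed

definition neighborhood :: "real \<Rightarrow> 'a::euclidean_space set \<Rightarrow> 'a set" where
  "neighborhood \<delta> K = {y. infdist y K < \<delta>}"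


section \<open>Clean intersection and the alternating framework\<close>

definition clean_intersection_at ::
  "nat \<Rightarrow> 'a::euclidean_space set \<Rightarrow> 'a set \<Rightarrow> 'a \<Rightarrow> bool" where
  "clean_intersection_at p M1 M2 x \<longleftrightarrow>
     (\<exists>V. open V \<and> x \<in> V \<and> embedded_submanifold p (M1 \<inter> M2 \<inter> V) \<and>
        (\<forall>y\<in>M1 \<inter> M2 \<inter> V.
           tangent_space (M1 \<inter> M2) y = tangent_space M1 y \<inter> tangent_space M2 y))"

definition first_order_consistent ::
  "'a::euclidean_space set \<Rightarrow> ('a \<Rightarrow> 'a) \<Rightarrow> 'a set \<Rightarrow> bool" where
  "first_order_consistent V \<phi> M \<longleftrightarrow>
     (\<forall>x\<in>V \<inter> M. (\<lambda>y. norm (\<phi> y - closest_point M y)) \<in> o[at x](\<lambda>y. infdist y M))"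

definition alternating_framework_at ::
  "nat \<Rightarrow> 'a::euclidean_space set \<Rightarrow> 'a set \<Rightarrow> ('a \<Rightarrow> 'a) \<Rightarrow> ('a \<Rightarrow> 'a) \<Rightarrow> 'a \<Rightarrow> bool" where
  "alternating_framework_at p M1 M2 \<phi>1 \<phi>2 x \<longleftrightarrow>
     (\<exists>V. open V \<and> x \<in> V \<and> Ck (p - 1) V \<phi>1 \<and> Ck (p - 1) V \<phi>2 \<and> \<phi>1 ` V \<subseteq> M1 \<and>
        ((\<forall>y\<in>V. \<phi>1 y = closest_point M1 y) \<and> first_order_consistent V \<phi>2 M2 \<or>
         (\<forall>y\<in>V. \<phi>2 y = closest_point M2 y) \<and> first_order_consistent V \<phi>1 M1 \<or>
         first_order_consistent V \<phi>1 M1 \<and> first_order_consistent V \<phi>2 M2 \<and>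
           \<phi>1 ` V \<subseteq> M1 \<and> \<phi>2 ` V \<subseteq> M2))"


section \<open>Local sets, radius and decomposition property\<close>

text \<open>
  \<open>W\<close> is the neighborhood of \<open>xbar\<close> in \<open>M1 \<inter> M2\<close> and \<open>U\<close> the one in the ambient space.
  The maps \<open>\<phi>1\<close> and \<open>\<phi>2\<close> are total functions; \<open>U\<close> plays the role of their domain, so that
  \<open>\<phi>1 (\<phi>2 y)\<close> counts as well-defined when both \<open>y\<close> and \<open>\<phi>2 y\<close> lie in \<open>U\<close>.
\<close>

definition local_sets ::
  "nat \<Rightarrow> 'a::euclidean_space set \<Rightarrow> 'a set \<Rightarrow> ('a \<Rightarrow> 'a) \<Rightarrow> ('a \<Rightarrow> 'a) \<Rightarrow> 'a \<Rightarrow>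
   'a set \<Rightarrow> 'a set \<Rightarrow> 'a set \<Rightarrow> 'a set \<Rightarrow> bool" where
  "local_sets p M1 M2 \<phi>1 \<phi>2 xbar W U \<Omega> K \<longleftrightarrow>
     (let M = M1 \<inter> M2 in
        openin (top_of_set M) W \<and> xbar \<in> W \<and> open U \<and> xbar \<in> U \<and>
        (\<forall>x\<in>W. tangent_space M x = tangent_space M1 x \<inter> tangent_space M2 x) \<and>
        (\<exists>c<1. \<forall>x\<in>W.
           onorm (\<lambda>u. closest_point (tangent_space M1 x) (closest_point (tangent_space M2 x) u)
                        - closest_point (tangent_space M x) u) \<le> c) \<and>
        (\<forall>D\<in>{M1, M2, M}. projection_defined_on U D \<and> Ck1 (p - 1) U (closest_point D)) \<and>
        Ck1 (p - 1) U \<phi>1 \<and> Ck1 (p - 1) U \<phi>2 \<and>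
        (\<exists>\<kappa>>0. \<forall>x\<in>M1 \<inter> U. infdist x M \<le> \<kappa> * infdist x M2) \<and>
        openin (top_of_set M) \<Omega> \<and> xbar \<in> \<Omega> \<and> \<Omega> \<subseteq> W \<inter> U \<and>
        K = (top_of_set M) closure_of \<Omega> \<and> compact K \<and> K \<subseteq> W \<inter> U)"

definition iterates_defined ::
  "'a::euclidean_space set \<Rightarrow> ('a \<Rightarrow> 'a) \<Rightarrow> ('a \<Rightarrow> 'a) \<Rightarrow> 'a \<Rightarrow> bool" where
  "iterates_defined U \<phi>1 \<phi>2 y \<longleftrightarrow>
     (\<forall>k. ((\<phi>1 \<circ> \<phi>2) ^^ k) y \<in> U \<and> \<phi>2 (((\<phi>1 \<circ> \<phi>2) ^^ k) y) \<in> U)"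

definition admissible_radius ::
  "'a::euclidean_space set \<Rightarrow> 'a set \<Rightarrow> ('a \<Rightarrow> 'a) \<Rightarrow> ('a \<Rightarrow> 'a) \<Rightarrow> 'a set \<Rightarrow> 'a set \<Rightarrow> 'a set \<Rightarrow>
   real \<Rightarrow> real \<Rightarrow> real \<Rightarrow> real \<Rightarrow> bool" where
  "admissible_radius M1 M2 \<phi>1 \<phi>2 U \<Omega> K \<delta> \<tau> \<rho> C \<longleftrightarrow>
     0 < \<delta> \<and> neighborhood \<delta> K \<subseteq> U \<and> 0 < \<tau> \<and> \<tau> < 1 \<and> 0 < \<rho> \<and> \<rho> \<le> \<delta> \<and> 1 < C \<and>
     (\<forall>y\<in>M1 \<inter> neighborhood \<delta> K.
        \<phi>2 y \<in> U \<and> infdist ((\<phi>1 \<circ> \<phi>2) y) M2 \<le> \<tau> * infdist y M2) \<and>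
     (\<forall>x\<in>\<Omega>. \<forall>\<eta>\<in>tangent_space (M1 \<inter> M2) x. norm \<eta> \<le> \<rho> \<longrightarrow>
        iterates_defined U \<phi>1 \<phi>2 (x + \<eta>) \<and>
        x + \<eta> \<in> neighborhood \<delta> K \<and> \<phi>2 (x + \<eta>) \<in> neighborhood \<delta> K \<and>
        (\<forall>k\<ge>1. ((\<phi>1 \<circ> \<phi>2) ^^ k) (x + \<eta>) \<in> M1 \<inter> neighborhood \<delta> K \<and>
                \<phi>2 (((\<phi>1 \<circ> \<phi>2) ^^ k) (x + \<eta>)) \<in> neighborhood \<delta> K \<and>
                norm (((\<phi>1 \<circ> \<phi>2) ^^ k) (x + \<eta>) - x) \<le> C * norm \<eta>))"

text \<open>
  The last two conjuncts of the next definition express, with constants independent of \<open>x \<in> K\<close>,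
  that along every family of points with \<open>u \<rightarrow> 0\<close> and \<open>P\<^sub>N(u) = o(\<parallel>u\<parallel>)\<close> one has
  \<open>R\<^sub>N(x,u) = O(\<parallel>u\<parallel>\<^sup>2)\<close> and \<open>R\<^sub>T(x,u) = o(\<parallel>u\<parallel>\<^sup>2)\<close>: on such a family
  the bound \<open>\<parallel>P\<^sub>N(u)\<parallel> \<le> \<theta> \<parallel>u\<parallel>\<close> eventually holds for every \<open>\<theta> > 0\<close>.
\<close>

definition decomposition_of ::
  "nat \<Rightarrow> 'a::euclidean_space set \<Rightarrow> ('a \<Rightarrow> 'a) \<Rightarrow> 'a set \<Rightarrow> real \<Rightarrow> bool" where
  "decomposition_of p M \<phi> K \<delta> \<longleftrightarrow>
     (\<exists>RN RT :: 'a \<times> 'a \<Rightarrow> 'a.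
        Ck_within (p - 1) (K \<times> ball 0 \<delta>) RN \<and> Ck_within (p - 1) (K \<times> ball 0 \<delta>) RT \<and>
        (\<forall>x\<in>K. \<forall>u\<in>ball 0 \<delta>.
           RN (x, u) \<in> normal_space M x \<and> RT (x, u) \<in> tangent_space M x \<and>
           \<phi> (x + u) = x + closest_point (tangent_space M x) u + RN (x, u) + RT (x, u)) \<and>
        (\<exists>B. \<exists>\<theta>>0. \<exists>r>0. \<forall>x\<in>K. \<forall>u.
           x + u \<in> neighborhood \<delta> K \<and> norm u < r \<and>
           norm (closest_point (normal_space M x) u) \<le> \<theta> * norm u \<longrightarrow>
           norm (RN (x, u)) \<le> B * (norm u)\<^sup>2) \<and>
        (\<forall>\<epsilon>>0. \<exists>\<theta>>0. \<exists>r>0. \<forall>x\<in>K. \<forall>u.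
           x + u \<in> neighborhood \<delta> K \<and> norm u < r \<and>
           norm (closest_point (normal_space M x) u) \<le> \<theta> * norm u \<longrightarrow>
           norm (RT (x, u)) \<le> \<epsilon> * (norm u)\<^sup>2))"

definition lipschitz_second_derivative_on ::
  "'a::euclidean_space set \<Rightarrow> ('a \<Rightarrow> 'a) \<Rightarrow> bool" where
  "lipschitz_second_derivative_on S f \<longleftrightarrow>
     (\<exists>(D1 :: 'a \<Rightarrow> 'a \<Rightarrow>\<^sub>L 'a) (D2 :: 'a \<Rightarrow> 'a \<Rightarrow>\<^sub>L 'a \<Rightarrow>\<^sub>L 'a) L.
        (\<forall>x\<in>S. (f has_derivative blinfun_apply (D1 x)) (at x)) \<and>
        (\<forall>x\<in>S. (D1 has_derivative blinfun_apply (D2 x)) (at x)) \<and>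
        L-lipschitz_on S D2)"

definition decomposition_property ::
  "nat \<Rightarrow> 'a::euclidean_space set \<Rightarrow> 'a set \<Rightarrow> ('a \<Rightarrow> 'a) \<Rightarrow> ('a \<Rightarrow> 'a) \<Rightarrow>
   'a set \<Rightarrow> 'a set \<Rightarrow> real \<Rightarrow> bool" where
  "decomposition_property p M1 M2 \<phi>1 \<phi>2 U K \<delta> \<longleftrightarrow>
     decomposition_of p M1 \<phi>1 K \<delta> \<and> decomposition_of p M2 \<phi>2 K \<delta> \<and>
     \<phi>2 ` neighborhood \<delta> K \<subseteq> U \<and>
     Ck1 2 (neighborhood \<delta> K) (\<phi>1 \<circ> \<phi>2) \<and>
     lipschitz_second_derivative_on (neighborhood \<delta> K) (\<phi>1 \<circ> \<phi>2)"


section \<open>Retractions\<close>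

definition retraction_domain ::
  "'a::euclidean_space set \<Rightarrow> 'a set \<Rightarrow> real \<Rightarrow> ('a \<times> 'a) set" where
  "retraction_domain M \<Omega> \<rho> = {(x, \<eta>) \<in> tangent_bundle M. x \<in> \<Omega> \<and> norm \<eta> < \<rho>}"

definition first_order_retraction ::
  "'a::euclidean_space set \<Rightarrow> ('a \<times> 'a) set \<Rightarrow> ('a \<times> 'a \<Rightarrow> 'a) \<Rightarrow> bool" where
  "first_order_retraction M D \<psi> \<longleftrightarrow>
     \<psi> ` D \<subseteq> M \<and> Ck_within 1 D \<psi> \<and>
     (\<forall>(x, \<eta>)\<in>D. \<psi> (x, 0) = x \<and>
        ((\<lambda>t::real. \<psi> (x, t *\<^sub>R \<eta>)) has_vector_derivative \<eta>) (at 0))"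

definition second_order_retraction ::
  "'a::euclidean_space set \<Rightarrow> ('a \<times> 'a) set \<Rightarrow> ('a \<times> 'a \<Rightarrow> 'a) \<Rightarrow> bool" where
  "second_order_retraction M D \<psi> \<longleftrightarrow>
     \<psi> ` D \<subseteq> M \<and> Ck_within 2 D \<psi> \<and>
     (\<forall>(x, \<eta>)\<in>D. \<psi> (x, 0) = x \<and>
        (\<lambda>t::real. norm (\<psi> (x, t *\<^sub>R \<eta>) - (x + t *\<^sub>R \<eta>))) \<in> o[at 0](\<lambda>t. t) \<and>
        (\<lambda>t::real. norm (closest_point (tangent_space M x) (\<psi> (x, t *\<^sub>R \<eta>) - (x + t *\<^sub>R \<eta>))))
          \<in> o[at 0](\<lambda>t. t\<^sup>2))"

end

theory Submission
  imports Defs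
begin

text \<open>
  The idea is to study the iterates of \<open>\<phi> = \<phi>\<^sub>1 \<circ> \<phi>\<^sub>2\<close> from all starting points \<open>y\<close> in an open
  neighborhood of \<open>K\<close> in the ambient space, and to write \<open>\<psi>(x, \<eta>) = \<Phi>(x + \<eta>)\<close> with
  \<open>\<Phi>(y) = lim \<phi>\<^sup>k(y)\<close>.

  Every \<open>z \<in> M\<close> near \<open>K\<close> is a fixed point of \<open>\<phi>\<close>. First-order consistency gives
  \<open>D\<phi>\<^sub>i(z) = DP\<^sub>i(z)\<close>, where \<open>P\<^sub>i\<close> is the projection onto \<open>M\<^sub>i\<close>, and \<open>DP\<^sub>i(z)\<close> is the
  orthogonal projector onto the tangent space of \<open>M\<^sub>i\<close>. So \<open>A = D\<phi>(z)\<close> is a product of two tangent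
  projectors: it is the identity on the tangent space \<open>T\<close> of \<open>M\<close> and, by the angle bound that comes with
  the clean intersection, a contraction on the normal space. In other words, \<open>M\<close> consists of fixed points
  and attracts in the normal directions. Orbits starting near \<open>K\<close> converge at a uniform geometric rate
  (\<open>orbit_converges\<close>).

  For \<open>\<Phi>\<close> to be \<open>C\<^sup>2\<close>, the first two derivatives of \<open>\<phi>\<^sup>k\<close> have to converge locally uniformly. Along an
  orbit \<open>y\<^sub>k\<close> with limit \<open>z\<close>, the chain rule gives the recursions
  \<open>v\<^sub>k\<^sub>+\<^sub>1 = D\<phi>(y\<^sub>k) v\<^sub>k\<close> and \<open>s\<^sub>k\<^sub>+\<^sub>1 = D\<phi>(y\<^sub>k) s\<^sub>k + D\<^sup>2\<phi>(y\<^sub>k)[w\<^sub>k, v\<^sub>k]\<close>, whose coefficients converge geometrically.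
  The first one converges to a vector of \<open>T\<close>. In the second one the forcing does not tend to zero, and
  since \<open>A\<close> is the identity on \<open>T\<close>, a tangential forcing would accumulate. It does not occur:
  \<open>D\<^sup>2\<phi>(z)[w, v]\<close> is normal for \<open>w\<close>, \<open>v\<close> in \<open>T\<close> (\<open>second_derivative_normal\<close>), because
  \<open>D\<phi> - I\<close> vanishes on the tangent spaces of \<open>M\<close> and maps into the normal spaces. Hence the second
  recursion converges as well (\<open>affine_recursion_limit\<close>).

  The same fact gives the second-order property. At a point \<open>x\<close> of \<open>K\<close> and for \<open>\<eta>\<close> tangent, the second
  recursion is \<open>s\<^sub>k\<^sub>+\<^sub>1 = A s\<^sub>k + D\<^sup>2\<phi>(x)[\<eta>, \<eta>]\<close> with \<open>s\<^sub>0 = 0\<close>. It stays in the normal space, so that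
  \<open>D\<^sup>2\<Phi>(x)[\<eta>, \<eta>]\<close> has no tangential part, and \<open>t \<mapsto> \<Phi>(x + t \<eta>)\<close> has zero intrinsic acceleration.
\<close>


section \<open>Affine recursions with converging coefficients\<close>

text \<open>
  The quantity \<open>h + s k + d k / (1 - c)\<close> grows in each step at most by a factor
  \<open>1 + K \<theta>\<^sup>k / (1 - c)\<close>, because the weight \<open>1 / (1 - c)\<close> absorbs the step \<open>s k + d k\<close>. The infinite
  product of these factors converges, so \<open>s\<close> stays bounded, and the recursion for \<open>d\<close> becomes a
  contraction with geometric forcing. The constant \<open>H\<close> depends on \<open>c\<close>, \<open>\<theta>\<close> and \<open>K\<close> only; the bound
  is homogeneous in \<open>h\<close>, \<open>s 0\<close> and \<open>d 0\<close>, which later makes the convergence of derivatives uniform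
  in the directions in which they are evaluated.
\<close>

lemma geometric_forcing_bound:
  fixes c \<theta> K :: real
  assumes "0 \<le> c" "c < \<theta>" "\<theta> < 1" "0 \<le> K"
  obtains H where "0 \<le> H"
    "\<And>h d s k. \<lbrakk>0 \<le> h; \<And>k. 0 \<le> d k; \<And>k. 0 \<le> s k; \<And>k. s (Suc k) \<le> s k + d k;
        \<And>k. d (Suc k) \<le> c * d k + K * \<theta> ^ k * (h + s k + d k)\<rbrakk>
      \<Longrightarrow> d k \<le> H * (h + s 0 + d 0) * \<theta> ^ k"
proof -
  define l where "l = 1 / (1 - c)"
  have c1: "0 < 1 - c" "c \<noteq> 1"
    using assms by auto
  have l: "1 \<le> l" "1 + l * c = l"
    using assms c1 by (simp_all add: l_def field_simps)
  define X where "X = exp (l * K / (1 - \<theta>))"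
  define H where "H = l + K * X * l / (\<theta> - c)"
  have H0: "0 \<le> H"
    using assms l by (auto simp: H_def X_def)
  have bound: "d k \<le> H * (h + s 0 + d 0) * \<theta> ^ k"
    if h: "0 \<le> h" and d: "\<And>k. 0 \<le> d k" and s: "\<And>k. 0 \<le> s k"
      and ss: "\<And>k. s (Suc k) \<le> s k + d k"
      and dd: "\<And>k. d (Suc k) \<le> c * d k + K * \<theta> ^ k * (h + s k + d k)"
    for h :: real and d s :: "nat \<Rightarrow> real" and k
  proof -
    define E where "E = (\<lambda>k. h + s k + l * d k)"
    have ld: "d k \<le> l * d k" for k
      using mult_right_mono[OF l(1) d[of k]] by simp
    have E0: "0 \<le> E k" for k
      unfolding E_def using h s[of k] d[of k] l(1) by simp
    have Estep: "E (Suc k) \<le> (1 + l * K * \<theta> ^ k) * E k" for k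
    proof -
      have "E (Suc k) \<le> h + (s k + d k) + l * (c * d k + K * \<theta> ^ k * (h + s k + d k))"
        unfolding E_def using ss[of k] mult_left_mono[OF dd[of k], of l] l(1) by linarith
      also have "\<dots> = h + s k + (1 + l * c) * d k + l * K * \<theta> ^ k * (h + s k + d k)"
        by (simp add: algebra_simps)
      also have "\<dots> = E k + l * K * \<theta> ^ k * (h + s k + d k)"
        by (simp only: l(2) E_def)
      also have "\<dots> \<le> E k + l * K * \<theta> ^ k * E k"
        using assms l(1) ld[of k] by (intro add_left_mono mult_left_mono) (auto simp: E_def)
      finally show ?thesis by (simp add: algebra_simps)
    qed
    have Eexp: "E k \<le> exp (l * K * (\<Sum>j<k. \<theta> ^ j)) * E 0" for k
    proof (induction k)
      case (Suc k)
      have "E (Suc k) \<le> exp (l * K * \<theta> ^ k) * E k"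
        by (rule order_trans[OF Estep]) (intro mult_right_mono E0 exp_ge_add_one_self)
      also have "\<dots> \<le> exp (l * K * \<theta> ^ k) * (exp (l * K * (\<Sum>j<k. \<theta> ^ j)) * E 0)"
        using Suc by (intro mult_left_mono) auto
      finally show ?case by (simp add: exp_add algebra_simps)
    qed simp
    have "(\<Sum>j<k. \<theta> ^ j) \<le> 1 / (1 - \<theta>)" for k
    proof -
      have "(\<Sum>j<k. \<theta> ^ j) \<le> (\<Sum>j. \<theta> ^ j)"
        using assms by (intro sum_le_suminf summable_geometric) auto
      then show ?thesis using assms by (simp add: suminf_geometric)
    qed
    then have "exp (l * K * (\<Sum>j<k. \<theta> ^ j)) \<le> X" for k
      unfolding X_def using assms l(1) mult_left_mono[of "\<Sum>j<k. \<theta> ^ j" "1 / (1 - \<theta>)" "l * K"]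
      by simp
    then have EX: "E k \<le> X * E 0" for k
      using order_trans[OF Eexp mult_right_mono[OF _ E0]] by blast
    define e where "e = h + s 0 + d 0"
    have e0: "0 \<le> e"
      using h s[of 0] d[of 0] by (simp add: e_def)
    have E0e: "E 0 \<le> l * e"
      using h s[of 0] l(1) mult_right_mono[OF l(1), of "h + s 0"]
      by (simp add: E_def e_def algebra_simps)
    have "X * E 0 \<le> X * (l * e)"
      using E0e by (intro mult_left_mono) (auto simp: X_def)
    then have hs: "h + s k + d k \<le> X * l * e" for k
      using EX[of k] ld[of k] by (simp add: E_def algebra_simps)
    have "d k \<le> H * e * \<theta> ^ k"
    proof (induction k)
      case 0
      have "d 0 \<le> e" using h s[of 0] by (simp add: e_def)
      also have "\<dots> \<le> H * e"
        using l assms e0 mult_right_mono[of 1 H e] by (simp add: H_def X_def add_increasing2)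
      finally show ?case by simp
    next
      case (Suc k)
      have "d (Suc k) \<le> c * d k + K * \<theta> ^ k * (h + s k + d k)" by (rule dd)
      also have "\<dots> \<le> c * (H * e * \<theta> ^ k) + K * \<theta> ^ k * (X * l * e)"
        using Suc hs assms by (intro add_mono mult_left_mono) auto
      also have "\<dots> = (c * H + K * X * l) * (e * \<theta> ^ k)" by (simp add: algebra_simps)
      also have "\<dots> \<le> (\<theta> * H) * (e * \<theta> ^ k)"
      proof (rule mult_right_mono)
        have "(\<theta> - c) * H = (\<theta> - c) * l + K * X * l"
          using assms by (simp add: H_def distrib_left)
        moreover have "0 \<le> (\<theta> - c) * l"
          using assms l by simp
        ultimately have "K * X * l \<le> (\<theta> - c) * H" by simp
        then show "c * H + K * X * l \<le> \<theta> * H" by (simp add: algebra_simps)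
      qed (use e0 assms in auto)
      finally show ?case by (simp add: algebra_simps)
    qed
    then show ?thesis by (simp add: e_def)
  qed
  show thesis
    by (rule that[OF H0]) (rule bound)
qed

lemma geometric_steps_limit:
  fixes S :: "nat \<Rightarrow> 'a::banach"
  assumes "\<And>k. norm (S (Suc k) - S k) \<le> C * \<theta> ^ k" "0 \<le> \<theta>" "\<theta> < 1"
  shows "S \<longlonglongrightarrow> lim S" "norm (S k - lim S) \<le> C / (1 - \<theta>) * \<theta> ^ k"
proof -
  have sg: "summable (\<lambda>j. C * \<theta> ^ (j + k))" for k
    using assms by (simp add: power_add summable_mult2 summable_mult mult.assoc[symmetric])
  have sd: "summable (\<lambda>j. S (Suc (j + k)) - S (j + k))" for k
    by (rule summable_comparison_test'[OF sg[of k], of 0]) (use assms(1) in auto)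
  have lim: "(\<lambda>n. S (n + k)) \<longlonglongrightarrow> (\<Sum>j. S (Suc (j + k)) - S (j + k)) + S k" for k
  proof -
    have "(\<lambda>n. (\<Sum>j<n. S (Suc (j + k)) - S (j + k)) + S k) \<longlonglongrightarrow> (\<Sum>j. S (Suc (j + k)) - S (j + k)) + S k"
      by (intro tendsto_add tendsto_const summable_LIMSEQ sd)
    moreover have "(\<Sum>j<n. S (Suc (j + k)) - S (j + k)) + S k = S (n + k)" for n
      using sum_lessThan_telescope[of "\<lambda>j. S (j + k)" n] by simp
    ultimately show ?thesis by simp
  qed
  have "convergent S"
    using convergentI[OF lim[of 0]] by simp
  then show conv: "S \<longlonglongrightarrow> lim S"
    by (simp only: convergent_LIMSEQ_iff)
  have "(\<lambda>n. S (n + k)) \<longlonglongrightarrow> lim S"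
    using conv by (rule LIMSEQ_ignore_initial_segment)
  then have "lim S - S k = (\<Sum>j. S (Suc (j + k)) - S (j + k))"
    using LIMSEQ_unique[OF lim[of k]] by (simp add: algebra_simps)
  then have "norm (S k - lim S) = norm (\<Sum>j. S (Suc (j + k)) - S (j + k))"
    by (simp only: norm_minus_commute[of "S k"])
  also have "\<dots> \<le> (\<Sum>j. C * \<theta> ^ (j + k))"
    by (rule norm_suminf_le[OF assms(1) sg])
  also have "\<dots> = C / (1 - \<theta>) * \<theta> ^ k"
  proof -
    have "(\<lambda>j. (C * \<theta> ^ k) * \<theta> ^ j) sums ((C * \<theta> ^ k) * (1 / (1 - \<theta>)))"
      using assms by (intro sums_mult geometric_sums) auto
    then show ?thesis
      by (simp add: sums_unique[symmetric] power_add algebra_simps)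
  qed
  finally show "norm (S k - lim S) \<le> C / (1 - \<theta>) * \<theta> ^ k" .
qed

text \<open>
  Both the first and the second derivatives of the iterates of a map satisfy such a recursion. The limit
  operator \<open>Ainf\<close> may fix the range of \<open>P\<close>, so a constant forcing in this range would
  accumulate linearly; \<open>P Binf = 0\<close> excludes it. With \<open>D k = S (k + 1) - S k\<close>, the part
  \<open>P (D k)\<close> is then geometrically small, since \<open>P (Ainf u) = P u\<close>, and \<open>Ainf (D k)\<close> differs from
  it by \<open>(Ainf - P) (D k)\<close>, where \<open>Ainf - P\<close> is a contraction.
\<close>

lemma affine_recursion_limit:
  fixes c \<theta> K :: real
  assumes "0 \<le> c" "c < \<theta>" "\<theta> < 1" "0 \<le> K"
  obtains H where "0 \<le> H"
    "\<And>(S :: nat \<Rightarrow> 'a::banach) (A :: nat \<Rightarrow> 'a \<Rightarrow>\<^sub>L 'a) (Ainf :: 'a \<Rightarrow>\<^sub>L 'a) P B Binf h k.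
      \<lbrakk>\<And>k. S (Suc k) = blinfun_apply (A k) (S k) + B k; \<And>k. norm (A k - Ainf) \<le> K * \<theta> ^ k;
       \<And>k. norm (B k - Binf) \<le> h * \<theta> ^ k; linear P; \<And>u. P (blinfun_apply Ainf u) = P u; P Binf = 0;
       \<And>u. norm (P u) \<le> norm u; \<And>u. norm (blinfun_apply Ainf u - P u) \<le> c * norm u\<rbrakk>
      \<Longrightarrow> S \<longlonglongrightarrow> lim S \<and> norm (S k - lim S) \<le> H * (h + norm (S 0) + norm (S 1 - S 0)) * \<theta> ^ k"
proof -
  have K3: "0 \<le> 3 * K + 3" using assms by simp
  obtain H where H0: "0 \<le> H" and H:
    "\<And>h d s k. \<lbrakk>0 \<le> h; \<And>k. 0 \<le> d k; \<And>k. 0 \<le> s k; \<And>k. s (Suc k) \<le> s k + d k;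
        \<And>k. d (Suc k) \<le> c * d k + (3 * K + 3) * \<theta> ^ k * (h + s k + d k)\<rbrakk>
      \<Longrightarrow> d k \<le> H * (h + s 0 + d 0) * \<theta> ^ k"
    using geometric_forcing_bound[OF assms(1-3) K3] by blast
  have bound: "S \<longlonglongrightarrow> lim S \<and>
      norm (S k - lim S) \<le> (H / (1 - \<theta>)) * (h + norm (S 0) + norm (S 1 - S 0)) * \<theta> ^ k"
    if S: "\<And>k. S (Suc k) = blinfun_apply (A k) (S k) + B k" and A: "\<And>k. norm (A k - Ainf) \<le> K * \<theta> ^ k"
      and B: "\<And>k. norm (B k - Binf) \<le> h * \<theta> ^ k" and P: "linear P"
      and PA: "\<And>u. P (blinfun_apply Ainf u) = P u" and PB: "P Binf = 0"
      and Ple: "\<And>u. norm (P u) \<le> norm u"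
      and con: "\<And>u. norm (blinfun_apply Ainf u - P u) \<le> c * norm u"
    for S :: "nat \<Rightarrow> 'a" and A and Ainf :: "'a \<Rightarrow>\<^sub>L 'a" and P B Binf h k
  proof -
    interpret P: linear P by (rule P)
    define D where "D = (\<lambda>k. S (Suc k) - S k)"
    have h0: "0 \<le> h" using order_trans[OF norm_ge_zero B[of 0]] by simp
    have \<theta>0: "0 \<le> \<theta>" using assms by simp
    have \<theta>S: "x * \<theta> ^ Suc k \<le> x * \<theta> ^ k" if "0 \<le> x" for x k
      using assms that by (intro mult_left_mono power_decreasing) auto
    have step: "norm (D (Suc k)) \<le>
        c * norm (D k) + (3 * K + 3) * \<theta> ^ k * (h + norm (S k) + norm (D k))" for k
    proof -
      let ?a = "Ainf (D k) - P (D k)" and ?b = "P ((A k - Ainf) (S k)) + P (B k - Binf)"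
        and ?c = "(A (Suc k) - Ainf) (D k)"
        and ?d = "(A (Suc k) - Ainf) (S k) - (A k - Ainf) (S k)"
        and ?e = "(B (Suc k) - Binf) - (B k - Binf)"
      \<comment> \<open>The tangential part of the increment contains only the errors of the coefficients.\<close>
      have b: "?b = P (D k)"
        by (simp add: D_def S P.diff P.add blinfun.diff_left PA PB)
      have eq: "D (Suc k) = ?a + ?b + ?c + ?d + ?e"
        unfolding b by (simp add: D_def S blinfun.diff_left blinfun.diff_right blinfun.add_right)
      have ab: "norm ((A j - Ainf) u) \<le> K * \<theta> ^ j * norm u" for j u
        by (rule order_trans[OF norm_blinfun mult_right_mono[OF A]]) simp
      have ab': "norm ((A (Suc k) - Ainf) u) \<le> K * \<theta> ^ k * norm u" for u
        by (rule order_trans[OF ab mult_right_mono[OF \<theta>S]]) (use assms in auto)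
      have Bs: "norm (B (Suc k) - Binf) \<le> h * \<theta> ^ k"
        by (rule order_trans[OF B \<theta>S[OF h0]])
      have na: "norm ?a \<le> c * norm (D k)" by (rule con)
      have nb: "norm ?b \<le> K * \<theta> ^ k * norm (S k) + h * \<theta> ^ k"
        by (intro norm_triangle_le add_mono order_trans[OF Ple] ab B)
      have nc: "norm ?c \<le> K * \<theta> ^ k * norm (D k)" by (rule ab')
      have nd: "norm ?d \<le> K * \<theta> ^ k * norm (S k) + K * \<theta> ^ k * norm (S k)"
        by (intro norm_triangle_le_diff add_mono ab ab')
      have ne: "norm ?e \<le> h * \<theta> ^ k + h * \<theta> ^ k"
        by (intro norm_triangle_le_diff add_mono B Bs)
      have "norm (D (Suc k)) \<le> norm ?a + norm ?b + norm ?c + norm ?d + norm ?e"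
        unfolding eq by (intro norm_triangle_le add_mono order_refl)
      also have "\<dots> \<le> c * norm (D k) + \<theta> ^ k * (3 * K * norm (S k) + K * norm (D k) + 3 * h)"
        using na nb nc nd ne by (simp add: algebra_simps)
      also have "\<dots> \<le> c * norm (D k) + \<theta> ^ k * ((3 * K + 3) * (h + norm (S k) + norm (D k)))"
      proof -
        have "0 \<le> K * h" "0 \<le> K * norm (D k)" "0 \<le> norm (S k)" "0 \<le> norm (D k)"
          using assms(4) h0 by auto
        then have "3 * K * norm (S k) + K * norm (D k) + 3 * h
            \<le> (3 * K + 3) * (h + norm (S k) + norm (D k))"
          by (simp add: ring_distribs)
        then show ?thesis
          using \<theta>0 by (intro add_left_mono mult_left_mono) auto
      qed
      finally show ?thesis by (simp add: mult_ac)
    qed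
    have "norm (D k) \<le> H * (h + norm (S 0) + norm (D 0)) * \<theta> ^ k" for k
    proof (rule H[OF h0 _ _ _ step])
      show "norm (S (Suc k)) \<le> norm (S k) + norm (D k)" for k
        unfolding D_def by (metis norm_triangle_sub)
    qed auto
    then have "norm (S (Suc k) - S k) \<le> H * (h + norm (S 0) + norm (S 1 - S 0)) * \<theta> ^ k" for k
      by (simp add: D_def)
    from geometric_steps_limit[OF this \<theta>0 assms(3)] show ?thesis by simp
  qed
  show thesis
  proof (rule that)
    show "0 \<le> H / (1 - \<theta>)" using H0 assms by simp
  qed (rule bound)
qed


section \<open>Iterates near an attracting set of fixed points\<close>

text \<open>
  \<open>F\<close> is a set of fixed points of \<open>\<phi>\<close>, for instance a piece of a manifold with tangent projectors
  \<open>P z\<close>; at \<open>z \<in> F\<close> the derivative of \<open>\<phi>\<close> is the identity on the range of \<open>P z\<close> and a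
  contraction on its kernel. \<open>D1\<close> and \<open>D2\<close> are the first two derivatives of \<open>\<phi>\<close>, with bounds
  and Lipschitz constants on the region \<open>G\<close>, which the orbits starting in \<open>B\<close> never leave. The
  curvature condition \<open>P_D2\<close> is the reason why second derivatives of the iterates converge.
\<close>

locale attracting_fixed_set =
  fixes \<phi> \<Phi> :: "'a::euclidean_space \<Rightarrow> 'a"
    and D1 :: "'a \<Rightarrow> 'a \<Rightarrow>\<^sub>L 'a" and D2 :: "'a \<Rightarrow> 'a \<Rightarrow>\<^sub>L 'a \<Rightarrow>\<^sub>L 'a"
    and P :: "'a \<Rightarrow> 'a \<Rightarrow> 'a"
    and G F B :: "'a set"
    and L C c \<theta> :: real
  assumes constants: "0 \<le> L" "0 \<le> C" "0 \<le> c" "c < \<theta>" "\<theta> < 1"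
    and D1: "y \<in> G \<Longrightarrow> (\<phi> has_derivative blinfun_apply (D1 y)) (at y)"
    and D2: "y \<in> G \<Longrightarrow> (D1 has_derivative blinfun_apply (D2 y)) (at y)"
    and norm_D1: "y \<in> G \<Longrightarrow> norm (D1 y) \<le> L"
    and norm_D2: "y \<in> G \<Longrightarrow> norm (D2 y) \<le> L"
    and lipschitz_D1: "L-lipschitz_on G D1"
    and lipschitz_D2: "L-lipschitz_on G D2"
    and F_subset: "F \<subseteq> G"
    and fixed: "z \<in> F \<Longrightarrow> \<phi> z = z"
    and linear_P: "z \<in> F \<Longrightarrow> linear (P z)"
    and P_idem: "z \<in> F \<Longrightarrow> P z (P z u) = P z u"
    and norm_P: "z \<in> F \<Longrightarrow> norm (P z u) \<le> norm u"
    and P_D1: "z \<in> F \<Longrightarrow> P z (blinfun_apply (D1 z) u) = P z u"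
    and D1_P: "z \<in> F \<Longrightarrow> blinfun_apply (D1 z) (P z u) = P z u"
    and contraction: "z \<in> F \<Longrightarrow> norm (blinfun_apply (D1 z) u - P z u) \<le> c * norm u"
    and P_D2: "\<lbrakk>z \<in> F; P z a = a; P z b = b\<rbrakk> \<Longrightarrow> P z (blinfun_apply (blinfun_apply (D2 z) a) b) = 0"
    and open_B: "open B" and convex_B: "convex B"
    and orbit: "y \<in> B \<Longrightarrow> (\<phi> ^^ k) y \<in> G"
    and limit_in: "y \<in> B \<Longrightarrow> \<Phi> y \<in> F"
    and rate: "y \<in> B \<Longrightarrow> norm ((\<phi> ^^ k) y - \<Phi> y) \<le> C * \<theta> ^ k"
begin

text \<open>
  \<open>jet1 k y v\<close> is the derivative of \<open>\<phi>\<^sup>k\<close> at \<open>y\<close> in direction \<open>v\<close>, and \<open>jet2 k y v w\<close> is the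
  derivative of \<open>jet1 k _ v\<close> at \<open>y\<close> in direction \<open>w\<close>: the chain rule turns them into
  linear recursions along the orbit.
\<close>

primrec jet1 :: "nat \<Rightarrow> 'a \<Rightarrow> 'a \<Rightarrow> 'a" where
  "jet1 0 y v = v"
| "jet1 (Suc k) y v = D1 ((\<phi> ^^ k) y) (jet1 k y v)"

primrec jet2 :: "nat \<Rightarrow> 'a \<Rightarrow> 'a \<Rightarrow> 'a \<Rightarrow> 'a" where
  "jet2 0 y v w = 0"
| "jet2 (Suc k) y v w =
     D1 ((\<phi> ^^ k) y) (jet2 k y v w) + D2 ((\<phi> ^^ k) y) (jet1 k y w) (jet1 k y v)"

definition jet1_lim :: "'a \<Rightarrow> 'a \<Rightarrow> 'a" where
  "jet1_lim y v = lim (\<lambda>k. jet1 k y v)"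

definition jet2_lim :: "'a \<Rightarrow> 'a \<Rightarrow> 'a \<Rightarrow> 'a" where
  "jet2_lim y v w = lim (\<lambda>k. jet2 k y v w)"

lemma has_derivative_iterate:
  assumes "y \<in> B"
  shows "((\<phi> ^^ k) has_derivative jet1 k y) (at y)"
proof (induction k)
  case 0
  have "jet1 0 y = id" by (rule ext) simp
  then show ?case by (simp add: has_derivative_id)
next
  case (Suc k)
  have "jet1 (Suc k) y = blinfun_apply (D1 ((\<phi> ^^ k) y)) \<circ> jet1 k y"
    by (rule ext) simp
  then show ?case
    using diff_chain_at[OF Suc D1[OF orbit[OF assms]]] by (simp add: o_def)
qed

lemma has_derivative_jet1:
  assumes "y \<in> B"
  shows "((\<lambda>y. jet1 k y v) has_derivative jet2 k y v) (at y)"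
proof (induction k)
  case 0
  have "jet2 0 y v = (\<lambda>w. 0)" by (rule ext) simp
  then show ?case by simp
next
  case (Suc k)
  have "((\<lambda>y. D1 ((\<phi> ^^ k) y)) has_derivative (\<lambda>w. D2 ((\<phi> ^^ k) y) (jet1 k y w))) (at y)"
    using diff_chain_at[OF has_derivative_iterate[OF assms] D2[OF orbit[OF assms]]]
    by (simp add: o_def)
  note product = bounded_bilinear.FDERIV[OF bounded_bilinear_blinfun_apply this Suc]
  have "jet2 (Suc k) y v = (\<lambda>w. blinfun_apply (D1 ((\<phi> ^^ k) y)) (jet2 k y v w)
      + blinfun_apply (blinfun_apply (D2 ((\<phi> ^^ k) y)) (jet1 k y w)) (jet1 k y v))"
    by (rule ext) simp
  then show ?case using product by simp
qed

lemma continuous_iterate: "continuous_on B (\<phi> ^^ k)"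
  using has_derivative_iterate has_derivative_continuous
  by (intro continuous_at_imp_continuous_on) blast

lemma continuous_jet1: "continuous_on B (\<lambda>y. jet1 k y v)"
  using has_derivative_jet1 has_derivative_continuous
  by (intro continuous_at_imp_continuous_on) blast

lemma continuous_jet2: "continuous_on B (\<lambda>y. jet2 k y v w)"
proof (induction k)
  case (Suc k)
  have "continuous_on B (\<lambda>y. D1 ((\<phi> ^^ k) y))"
    using lipschitz_on_continuous_on[OF lipschitz_D1] orbit
    by (intro continuous_on_compose2[OF _ continuous_iterate]) auto
  moreover have "continuous_on B (\<lambda>y. D2 ((\<phi> ^^ k) y))"
    using lipschitz_on_continuous_on[OF lipschitz_D2] orbit
    by (intro continuous_on_compose2[OF _ continuous_iterate]) auto
  ultimately show ?case
    using Suc continuous_jet1 by (simp) (intro continuous_intros; simp)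
qed simp

lemma lipschitz_along_orbit:
  assumes "y \<in> B" "L-lipschitz_on G f"
  shows "norm (f ((\<phi> ^^ k) y) - f (\<Phi> y)) \<le> L * C * \<theta> ^ k"
proof -
  have "norm (f ((\<phi> ^^ k) y) - f (\<Phi> y)) \<le> L * norm ((\<phi> ^^ k) y - \<Phi> y)"
    using lipschitz_on_normD[OF assms(2)] orbit limit_in F_subset assms(1) by blast
  also have "\<dots> \<le> L * (C * \<theta> ^ k)"
    by (intro mult_left_mono rate assms constants)
  finally show ?thesis by simp
qed

lemma jet1_converges:
  "\<exists>H\<ge>0. \<forall>y\<in>B. \<forall>v k. (\<lambda>k. jet1 k y v) \<longlonglongrightarrow> jet1_lim y v \<and>
        norm (jet1 k y v - jet1_lim y v) \<le> H * norm v * \<theta> ^ k"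
proof -
  have LC: "0 \<le> L * C" using constants by simp
  show ?thesis
  proof (rule affine_recursion_limit[OF constants(3-5) LC])
    fix H :: real
    assume H0: "0 \<le> H" and H:
      "\<And>(S :: nat \<Rightarrow> 'a) A (Ainf :: 'a \<Rightarrow>\<^sub>L 'a) P B Binf h k.
        \<lbrakk>\<And>k. S (Suc k) = blinfun_apply (A k) (S k) + B k; \<And>k. norm (A k - Ainf) \<le> L * C * \<theta> ^ k;
         \<And>k. norm (B k - Binf) \<le> h * \<theta> ^ k; linear P; \<And>u. P (blinfun_apply Ainf u) = P u; P Binf = 0;
         \<And>u. norm (P u) \<le> norm u; \<And>u. norm (blinfun_apply Ainf u - P u) \<le> c * norm u\<rbrakk>
        \<Longrightarrow> S \<longlonglongrightarrow> lim S \<and> norm (S k - lim S) \<le> H * (h + norm (S 0) + norm (S 1 - S 0)) * \<theta> ^ k"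
    have "(\<lambda>k. jet1 k y v) \<longlonglongrightarrow> jet1_lim y v \<and>
          norm (jet1 k y v - jet1_lim y v) \<le> H * (2 + L) * norm v * \<theta> ^ k"
      if y: "y \<in> B" for y v k
    proof -
      have z: "\<Phi> y \<in> F" by (rule limit_in[OF y])
      have yG: "y \<in> G" using orbit[OF y, of 0] by simp
      have *: "(\<lambda>k. jet1 k y v) \<longlonglongrightarrow> jet1_lim y v \<and> norm (jet1 k y v - jet1_lim y v)
          \<le> H * (0 + norm (jet1 0 y v) + norm (jet1 1 y v - jet1 0 y v)) * \<theta> ^ k"
        unfolding jet1_lim_def
        by (rule H[where A = "\<lambda>k. D1 ((\<phi> ^^ k) y)" and Ainf = "D1 (\<Phi> y)" and P = "P (\<Phi> y)"
              and B = "\<lambda>k. 0" and Binf = 0])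
          (use z y in \<open>simp_all add: lipschitz_along_orbit[OF _ lipschitz_D1] linear_P P_D1 norm_P
              contraction linear_0\<close>)
      have "norm (blinfun_apply (D1 y) v) \<le> L * norm v"
        by (rule order_trans[OF norm_blinfun mult_right_mono[OF norm_D1[OF yG]]]) simp
      then have "0 + norm (jet1 0 y v) + norm (jet1 1 y v - jet1 0 y v) \<le> (2 + L) * norm v"
        using norm_triangle_ineq4[of "blinfun_apply (D1 y) v" v] by (simp add: algebra_simps)
      then have "H * (0 + norm (jet1 0 y v) + norm (jet1 1 y v - jet1 0 y v)) * \<theta> ^ k
          \<le> H * ((2 + L) * norm v) * \<theta> ^ k"
        using H0 constants by (intro mult_right_mono mult_left_mono) auto
      then show ?thesis using * by (simp add: mult.assoc)
    qed
    moreover have "0 \<le> H * (2 + L)" using H0 constants by simp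
    ultimately show ?thesis by blast
  qed
qed

text \<open>
  The limit is fixed by \<open>D1 (\<Phi> y)\<close>, and a contraction on the kernel of \<open>P (\<Phi> y)\<close> has no fixed vector
  there but \<open>0\<close>.
\<close>

lemma jet1_lim_tangent:
  assumes y: "y \<in> B"
  shows "P (\<Phi> y) (jet1_lim y v) = jet1_lim y v"
proof -
  obtain H where "\<And>y v k. y \<in> B \<Longrightarrow> (\<lambda>k. jet1 k y v) \<longlonglongrightarrow> jet1_lim y v \<and>
        norm (jet1 k y v - jet1_lim y v) \<le> H * norm v * \<theta> ^ k"
    using jet1_converges by blast
  then have lim: "(\<lambda>k. jet1 k y v) \<longlonglongrightarrow> jet1_lim y v" using y by blast
  have z: "\<Phi> y \<in> F" by (rule limit_in[OF y])
  let ?A = "D1 (\<Phi> y)" and ?P = "P (\<Phi> y)" and ?v = "jet1_lim y v"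
  have th: "(\<lambda>k. C * \<theta> ^ k) \<longlonglongrightarrow> 0" for C
    using constants tendsto_mult_right_zero[OF LIMSEQ_power_zero[of \<theta>]] by simp
  have "(\<lambda>k. D1 ((\<phi> ^^ k) y)) \<longlonglongrightarrow> ?A"
    using lipschitz_along_orbit[OF y lipschitz_D1]
    by (intro LIM_zero_cancel[OF Lim_null_comparison[OF _ th[of "L * C"]]]) simp
  then have "(\<lambda>k. jet1 (Suc k) y v) \<longlonglongrightarrow> ?A ?v"
    using lim by (auto intro: tendsto_intros)
  then have A: "?A ?v = ?v"
    using LIMSEQ_unique LIMSEQ_Suc[OF lim] by blast
  interpret Pz: linear ?P by (rule linear_P[OF z])
  define u where "u = ?v - ?P ?v"
  have "?A u = u" "?P u = 0"
    using z by (simp_all add: u_def blinfun.diff_right A D1_P Pz.diff P_idem)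
  then have "norm u \<le> c * norm u"
    using contraction[OF z, of u] by simp
  then have "(1 - c) * norm u \<le> 0" by (simp add: algebra_simps)
  then have "u = 0" using constants by (simp add: mult_le_0_iff)
  then show ?thesis by (simp add: u_def)
qed

text \<open>
  The forcing term tends to \<open>D2 (\<Phi> y)\<close> evaluated at two limits of \<open>jet1\<close>. Both limits are
  tangent, hence \<open>P_D2\<close> removes the part of the limit forcing that would accumulate.
\<close>

lemma jet2_converges:
  "\<exists>H\<ge>0. \<forall>y\<in>B. \<forall>v w k. (\<lambda>k. jet2 k y v w) \<longlonglongrightarrow> jet2_lim y v w \<and>
        norm (jet2 k y v w - jet2_lim y v w) \<le> H * norm v * norm w * \<theta> ^ k"
proof -
  have LC: "0 \<le> L * C" using constants by simp
  show ?thesis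
  proof (rule affine_recursion_limit[OF constants(3-5) LC])
    fix H :: real
    assume H0: "0 \<le> H" and H:
      "\<And>(S :: nat \<Rightarrow> 'a) A (Ainf :: 'a \<Rightarrow>\<^sub>L 'a) P B Binf h k.
        \<lbrakk>\<And>k. S (Suc k) = blinfun_apply (A k) (S k) + B k; \<And>k. norm (A k - Ainf) \<le> L * C * \<theta> ^ k;
         \<And>k. norm (B k - Binf) \<le> h * \<theta> ^ k; linear P; \<And>u. P (blinfun_apply Ainf u) = P u; P Binf = 0;
         \<And>u. norm (P u) \<le> norm u; \<And>u. norm (blinfun_apply Ainf u - P u) \<le> c * norm u\<rbrakk>
        \<Longrightarrow> S \<longlonglongrightarrow> lim S \<and> norm (S k - lim S) \<le> H * (h + norm (S 0) + norm (S 1 - S 0)) * \<theta> ^ k"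
    obtain I where I0: "0 \<le> I" and I: "\<And>y v k. y \<in> B \<Longrightarrow> (\<lambda>k. jet1 k y v) \<longlonglongrightarrow> jet1_lim y v \<and>
          norm (jet1 k y v - jet1_lim y v) \<le> I * norm v * \<theta> ^ k"
      using jet1_converges by blast
    define J where "J = 1 + 2 * I"
    have \<theta>1: "0 \<le> \<theta>" "\<theta> ^ k \<le> 1" for k
      using constants by (auto intro: power_le_one)
    have J: "norm (jet1_lim y v) \<le> J * norm v" "norm (jet1 k y v) \<le> J * norm v" if "y \<in> B" for y v k
    proof -
      have a: "norm (v - jet1_lim y v) \<le> I * norm v"
        using I[OF that, of v 0] by simp
      have b: "norm (jet1_lim y v) \<le> norm v + norm (v - jet1_lim y v)"
        by (metis norm_minus_commute norm_triangle_sub)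
      have c: "norm (jet1 k y v - jet1_lim y v) \<le> I * norm v"
        using I[OF that, of v k] mult_left_mono[OF \<theta>1(2)[of k], of "I * norm v"] I0 by simp
      have d: "norm (jet1 k y v) \<le> norm (jet1_lim y v) + norm (jet1 k y v - jet1_lim y v)"
        by (rule norm_triangle_sub)
      have I': "0 \<le> I * norm v" using I0 by simp
      show "norm (jet1_lim y v) \<le> J * norm v" "norm (jet1 k y v) \<le> J * norm v"
        using a b c d I' by (simp_all add: J_def algebra_simps)
    qed
    define X where "X = L * C * J * J + 2 * L * I * J"
    have J0: "0 \<le> J" using I0 by (simp add: J_def)
    have X0: "0 \<le> X" using constants I0 J0 by (simp add: X_def)
    have apply2: "norm (blinfun_apply (blinfun_apply T a) b) \<le> t * s * r"
      if "norm T \<le> t" "norm a \<le> s" "norm b \<le> r" for T :: "'a \<Rightarrow>\<^sub>L 'a \<Rightarrow>\<^sub>L 'a" and a b t s r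
    proof -
      have "norm (blinfun_apply (blinfun_apply T a) b) \<le> norm (blinfun_apply T a) * norm b"
        by (rule norm_blinfun)
      also have "\<dots> \<le> (norm T * norm a) * norm b"
        by (intro mult_right_mono norm_blinfun) simp
      also have "\<dots> \<le> (t * s) * r"
        using that by (intro mult_mono) (auto intro: order_trans[OF norm_ge_zero] mult_nonneg_nonneg)
      finally show ?thesis .
    qed
    have "(\<lambda>k. jet2 k y v w) \<longlonglongrightarrow> jet2_lim y v w \<and>
          norm (jet2 k y v w - jet2_lim y v w) \<le> H * (X + L) * norm v * norm w * \<theta> ^ k"
      if y: "y \<in> B" for y v w k
    proof -
      have z: "\<Phi> y \<in> F" by (rule limit_in[OF y])
      have yG: "y \<in> G" using orbit[OF y, of 0] by simp
      have zG: "\<Phi> y \<in> G" using z F_subset by blast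
      let ?w = "jet1_lim y w" and ?v = "jet1_lim y v"
      have forcing: "norm (D2 ((\<phi> ^^ k) y) (jet1 k y w) (jet1 k y v) - D2 (\<Phi> y) ?w ?v)
          \<le> X * (norm v * norm w) * \<theta> ^ k" for k
      proof -
        have "D2 ((\<phi> ^^ k) y) (jet1 k y w) (jet1 k y v) - D2 (\<Phi> y) ?w ?v =
            (D2 ((\<phi> ^^ k) y) - D2 (\<Phi> y)) (jet1 k y w) (jet1 k y v)
            + D2 (\<Phi> y) (jet1 k y w - ?w) (jet1 k y v) + D2 (\<Phi> y) ?w (jet1 k y v - ?v)"
          by (simp add: blinfun.diff_left blinfun.diff_right)
        also have "norm \<dots> \<le> (L * C * \<theta> ^ k) * (J * norm w) * (J * norm v)
            + L * (I * norm w * \<theta> ^ k) * (J * norm v) + L * (J * norm w) * (I * norm v * \<theta> ^ k)"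
          using I[OF y] J[OF y] lipschitz_along_orbit[OF y lipschitz_D2] norm_D2[OF zG]
          by (intro norm_triangle_le add_mono apply2) auto
        also have "\<dots> = X * (norm v * norm w) * \<theta> ^ k"
          by (simp add: X_def algebra_simps)
        finally show ?thesis .
      qed
      have *: "(\<lambda>k. jet2 k y v w) \<longlonglongrightarrow> jet2_lim y v w \<and> norm (jet2 k y v w - jet2_lim y v w)
          \<le> H * (X * (norm v * norm w) + norm (jet2 0 y v w) + norm (jet2 1 y v w - jet2 0 y v w)) * \<theta> ^ k"
        unfolding jet2_lim_def
        by (rule H[where A = "\<lambda>k. D1 ((\<phi> ^^ k) y)" and Ainf = "D1 (\<Phi> y)" and P = "P (\<Phi> y)"
              and B = "\<lambda>k. D2 ((\<phi> ^^ k) y) (jet1 k y w) (jet1 k y v)" and Binf = "D2 (\<Phi> y) ?w ?v"])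
          (use z y in \<open>simp_all add: lipschitz_along_orbit[OF _ lipschitz_D1] linear_P P_D1 norm_P
              contraction forcing P_D2 jet1_lim_tangent\<close>)
      have "norm (D2 y w v) \<le> L * norm w * norm v"
        by (rule apply2[OF norm_D2[OF yG]]) auto
      then have "X * (norm v * norm w) + norm (jet2 0 y v w) + norm (jet2 1 y v w - jet2 0 y v w)
          \<le> (X + L) * (norm v * norm w)"
        by (simp add: algebra_simps)
      then have "H * (X * (norm v * norm w) + norm (jet2 0 y v w) + norm (jet2 1 y v w - jet2 0 y v w)) * \<theta> ^ k
          \<le> H * ((X + L) * (norm v * norm w)) * \<theta> ^ k"
        using H0 \<theta>1 by (intro mult_right_mono mult_left_mono) auto
      then show ?thesis using * by (simp add: mult.assoc)
    qed
    moreover have "0 \<le> H * (X + L)" using H0 X0 constants by simp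
    ultimately show ?thesis by blast
  qed
qed

lemma geometric_eventually_small:
  assumes "0 < e" shows "\<forall>\<^sub>F k in sequentially. K * \<theta> ^ k \<le> e"
proof -
  have "(\<lambda>k. K * \<theta> ^ k) \<longlonglongrightarrow> 0"
    using constants tendsto_mult_right_zero[OF LIMSEQ_power_zero[of \<theta>]] by simp
  from order_tendstoD(2)[OF this assms] show ?thesis
    by (rule eventually_mono) simp
qed

proposition has_derivative_limit:
  assumes y: "y \<in> B"
  shows "(\<Phi> has_derivative jet1_lim y) (at y)"
proof -
  obtain I where I: "\<And>y v k. y \<in> B \<Longrightarrow> (\<lambda>k. jet1 k y v) \<longlonglongrightarrow> jet1_lim y v \<and>
        norm (jet1 k y v - jet1_lim y v) \<le> I * norm v * \<theta> ^ k"
    using jet1_converges by blast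
  have lim: "(\<lambda>k. (\<phi> ^^ k) y) \<longlonglongrightarrow> \<Phi> y" if "y \<in> B" for y
  proof (rule LIM_zero_cancel, rule Lim_null_comparison)
    show "\<forall>\<^sub>F k in sequentially. norm ((\<phi> ^^ k) y - \<Phi> y) \<le> C * \<theta> ^ k"
      using rate[OF that] by simp
    show "(\<lambda>k. C * \<theta> ^ k) \<longlonglongrightarrow> 0"
      using constants tendsto_mult_right_zero[OF LIMSEQ_power_zero[of \<theta>]] by simp
  qed
  have "\<exists>g. \<forall>x\<in>B. (\<lambda>k. (\<phi> ^^ k) x) \<longlonglongrightarrow> g x \<and> (g has_derivative jet1_lim x) (at x within B)"
  proof (rule has_derivative_sequence[where f = "\<lambda>k. \<phi> ^^ k" and f' = jet1 and g' = jet1_lim and ?x0.0 = y and S = B])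
    show "convex B" by (rule convex_B)
    show "y \<in> B" by (rule y)
    show "(\<lambda>k. (\<phi> ^^ k) y) \<longlonglongrightarrow> \<Phi> y" by (rule lim[OF y])
    show "((\<phi> ^^ k) has_derivative jet1 k x) (at x within B)" if "x \<in> B" for k x
      by (rule has_derivative_at_withinI[OF has_derivative_iterate[OF that]])
    show "\<forall>\<^sub>F k in sequentially. \<forall>x\<in>B. \<forall>h. norm (jet1 k x h - jet1_lim x h) \<le> e * norm h"
      if "0 < e" for e
      using geometric_eventually_small[OF that, of I]
    proof (rule eventually_mono, intro ballI allI)
      fix k x h assume k: "I * \<theta> ^ k \<le> e" and x: "x \<in> B"
      have "norm (jet1 k x h - jet1_lim x h) \<le> (I * \<theta> ^ k) * norm h"
        using I[OF x, of h k] by (simp add: algebra_simps)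
      also have "\<dots> \<le> e * norm h" by (intro mult_right_mono k) simp
      finally show "norm (jet1 k x h - jet1_lim x h) \<le> e * norm h" .
    qed
  qed
  then obtain g where g: "\<And>x. x \<in> B \<Longrightarrow> (\<lambda>k. (\<phi> ^^ k) x) \<longlonglongrightarrow> g x"
      "\<And>x. x \<in> B \<Longrightarrow> (g has_derivative jet1_lim x) (at x within B)" by blast
  have "g x = \<Phi> x" if "x \<in> B" for x
    using LIMSEQ_unique[OF g(1)[OF that] lim[OF that]] .
  then show ?thesis
    using g(2)[OF y] y open_B
    by (metis at_within_open has_derivative_transform_within_open)
qed

proposition has_derivative_jet1_lim:
  assumes y: "y \<in> B"
  shows "((\<lambda>y. jet1_lim y v) has_derivative jet2_lim y v) (at y)"
proof -
  obtain I where I: "\<And>y v k. y \<in> B \<Longrightarrow> (\<lambda>k. jet1 k y v) \<longlonglongrightarrow> jet1_lim y v \<and>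
        norm (jet1 k y v - jet1_lim y v) \<le> I * norm v * \<theta> ^ k"
    using jet1_converges by blast
  obtain J where J: "\<And>y v w k. y \<in> B \<Longrightarrow> (\<lambda>k. jet2 k y v w) \<longlonglongrightarrow> jet2_lim y v w \<and>
        norm (jet2 k y v w - jet2_lim y v w) \<le> J * norm v * norm w * \<theta> ^ k"
    using jet2_converges by blast
  have lim: "(\<lambda>k. jet1 k y v) \<longlonglongrightarrow> jet1_lim y v" if "y \<in> B" for y
    using I[OF that] by blast
  have "\<exists>g. \<forall>x\<in>B. (\<lambda>k. jet1 k x v) \<longlonglongrightarrow> g x \<and> (g has_derivative jet2_lim x v) (at x within B)"
  proof (rule has_derivative_sequence[where f = "\<lambda>k y. jet1 k y v" and
        f' = "\<lambda>k y. jet2 k y v" and g' = "\<lambda>y. jet2_lim y v" and ?x0.0 = y and S = B])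
    show "convex B" by (rule convex_B)
    show "y \<in> B" by (rule y)
    show "(\<lambda>k. jet1 k y v) \<longlonglongrightarrow> jet1_lim y v" by (rule lim[OF y])
    show "((\<lambda>y. jet1 k y v) has_derivative jet2 k x v) (at x within B)" if "x \<in> B" for k x
      by (rule has_derivative_at_withinI[OF has_derivative_jet1[OF that]])
    show "\<forall>\<^sub>F k in sequentially. \<forall>x\<in>B. \<forall>h. norm (jet2 k x v h - jet2_lim x v h) \<le> e * norm h"
      if "0 < e" for e
      using geometric_eventually_small[OF that, of "J * norm v"]
    proof (rule eventually_mono, intro ballI allI)
      fix k x h assume k: "J * norm v * \<theta> ^ k \<le> e" and x: "x \<in> B"
      have "norm (jet2 k x v h - jet2_lim x v h) \<le> (J * norm v * \<theta> ^ k) * norm h"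
        using J[OF x, of v h k] by (simp add: algebra_simps)
      also have "\<dots> \<le> e * norm h" by (intro mult_right_mono k) simp
      finally show "norm (jet2 k x v h - jet2_lim x v h) \<le> e * norm h" .
    qed
  qed
  then obtain g where g: "\<And>x. x \<in> B \<Longrightarrow> (\<lambda>k. jet1 k x v) \<longlonglongrightarrow> g x"
      "\<And>x. x \<in> B \<Longrightarrow> (g has_derivative jet2_lim x v) (at x within B)" by blast
  have "g x = jet1_lim x v" if "x \<in> B" for x
    using LIMSEQ_unique[OF g(1)[OF that] lim[OF that]] .
  then show ?thesis
    using g(2)[OF y] y open_B
    by (metis (no_types, lifting) at_within_open has_derivative_transform_within_open)
qed

proposition continuous_jet2_lim: "continuous_on B (\<lambda>y. jet2_lim y v w)"
proof -
  obtain J where J: "\<And>y v w k. y \<in> B \<Longrightarrow> (\<lambda>k. jet2 k y v w) \<longlonglongrightarrow> jet2_lim y v w \<and>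
        norm (jet2 k y v w - jet2_lim y v w) \<le> J * norm v * norm w * \<theta> ^ k"
    using jet2_converges by blast
  have "uniform_limit B (\<lambda>k y. jet2 k y v w) (\<lambda>y. jet2_lim y v w) sequentially"
  proof (rule uniform_limitI)
    fix e :: real assume e: "0 < e"
    then have "\<forall>\<^sub>F k in sequentially. (J * norm v * norm w) * \<theta> ^ k \<le> e / 2"
      by (intro geometric_eventually_small) simp
    then show "\<forall>\<^sub>F k in sequentially. \<forall>y\<in>B. dist (jet2 k y v w) (jet2_lim y v w) < e"
    proof (rule eventually_mono, intro ballI)
      fix k y assume k: "J * norm v * norm w * \<theta> ^ k \<le> e / 2" and "y \<in> B"
      then have "norm (jet2 k y v w - jet2_lim y v w) \<le> e / 2"
        using J[of y v w k] by simp
      then show "dist (jet2 k y v w) (jet2_lim y v w) < e"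
        using e by (simp add: dist_norm)
    qed
  qed
  then show ?thesis
    by (rule uniform_limit_theorem[rotated]) (simp_all add: continuous_jet2)
qed

lemma iterate_fixed: "z \<in> F \<Longrightarrow> (\<phi> ^^ k) z = z"
  by (induction k) (simp_all add: fixed)

lemma jet1_fixed:
  assumes "z \<in> F" "P z v = v"
  shows "jet1 k z v = v"
proof (induction k)
  case (Suc k)
  then show ?case using D1_P[OF assms(1), of v] assms by (simp add: iterate_fixed)
qed simp

lemma jet1_lim_fixed:
  assumes "z \<in> F" "P z v = v"
  shows "jet1_lim z v = v"
  by (simp add: jet1_lim_def jet1_fixed[OF assms])

text \<open>
  At a fixed point the recursion for \<open>jet2\<close> has constant coefficients and starts at \<open>0\<close>; its forcing
  lies in the kernel of \<open>P z\<close>, which is invariant, so the recursion never leaves this kernel.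
\<close>

lemma P_jet2_lim:
  assumes z: "z \<in> F" "z \<in> B" and v: "P z v = v" and w: "P z w = w"
  shows "P z (jet2_lim z v w) = 0"
proof -
  interpret Pz: linear "P z" by (rule linear_P[OF z(1)])
  obtain J where J: "\<And>y v w k. y \<in> B \<Longrightarrow> (\<lambda>k. jet2 k y v w) \<longlonglongrightarrow> jet2_lim y v w \<and>
        norm (jet2 k y v w - jet2_lim y v w) \<le> J * norm v * norm w * \<theta> ^ k"
    using jet2_converges by blast
  then have lim: "(\<lambda>k. jet2 k z v w) \<longlonglongrightarrow> jet2_lim z v w" using z by blast
  have "P z (jet2 k z v w) = 0" for k
  proof (induction k)
    case (Suc k)
    then show ?case
      using z v w by (simp add: iterate_fixed Pz.add P_D1 jet1_fixed P_D2)
  qed simp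
  moreover have "(\<lambda>k. P z (jet2 k z v w)) \<longlonglongrightarrow> P z (jet2_lim z v w)"
    using lim linear_continuous_at[OF linear_conv_bounded_linear[THEN iffD1, OF linear_P[OF z(1)]]]
      isCont_tendsto_compose by blast
  ultimately show ?thesis
    by (simp add: LIMSEQ_const_iff)
qed

end


section \<open>Smooth projections and tangent spaces\<close>

definition orthogonal_projector :: "('a::euclidean_space \<Rightarrow> 'a) \<Rightarrow> bool" where
  "orthogonal_projector Q \<longleftrightarrow>
     linear Q \<and> (\<forall>u. Q (Q u) = Q u) \<and> (\<forall>a b. Q a \<bullet> b = a \<bullet> Q b)"

lemma orthogonal_projectorD:
  assumes "orthogonal_projector Q"
  shows "linear Q" "Q (Q u) = Q u" "Q a \<bullet> b = a \<bullet> Q b"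
  using assms by (auto simp: orthogonal_projector_def)

lemma norm_orthogonal_projector_le:
  assumes "orthogonal_projector Q"
  shows "norm (Q u) \<le> norm u"
proof -
  have "norm (Q u) * norm (Q u) = Q u \<bullet> Q u"
    by (simp add: power2_norm_eq_inner flip: power2_eq_square)
  also have "\<dots> = u \<bullet> Q u"
    by (metis assms orthogonal_projectorD(2,3))
  also have "\<dots> \<le> norm u * norm (Q u)"
    by (rule norm_cauchy_schwarz)
  finally show ?thesis
    by (cases "Q u = 0") auto
qed

lemma closest_point_orthogonal_projector:
  assumes "orthogonal_projector Q"
  shows "closest_point {v. Q v = v} u = Q u"
proof -
  interpret Q: linear Q by (rule orthogonal_projectorD(1)[OF assms])
  have sub: "subspace {v. Q v = v}"
    by (simp add: subspace_def Q.zero Q.add Q.scale)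
  show ?thesis
  proof (rule closest_point_unique[symmetric])
    show "convex {v. Q v = v}" "closed {v. Q v = v}"
      using sub by (auto intro: subspace_imp_convex closed_subspace)
    show "Q u \<in> {v. Q v = v}"
      by (simp add: orthogonal_projectorD[OF assms])
    show "\<forall>w\<in>{v. Q v = v}. dist u (Q u) \<le> dist u w"
    proof
      fix w assume "w \<in> {v. Q v = v}"
      then have w: "Q (Q u - w) = Q u - w"
        by (simp add: Q.diff orthogonal_projectorD[OF assms])
      have "(u - Q u) \<bullet> (Q u - w) = (u - Q u) \<bullet> Q (Q u - w)"
        by (simp only: w)
      also have "\<dots> = Q (u - Q u) \<bullet> (Q u - w)"
        by (simp only: orthogonal_projectorD(3)[OF assms])
      also have "\<dots> = 0"
        by (simp add: Q.diff orthogonal_projectorD(2)[OF assms])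
      finally have "orthogonal (u - Q u) (Q u - w)"
        by (simp add: orthogonal_def)
      from norm_add_Pythagorean[OF this]
      have "(norm (u - w))\<^sup>2 = (norm (u - Q u))\<^sup>2 + (norm (Q u - w))\<^sup>2" by simp
      then have "(norm (u - Q u))\<^sup>2 \<le> (norm (u - w))\<^sup>2" by simp
      then show "dist u (Q u) \<le> dist u w"
        by (simp add: dist_norm)
    qed
  qed
qed

lemma orthogonal_if_norm_minimal:
  fixes z w :: "'a::real_inner"
  assumes "\<And>s. norm z \<le> norm (z + s *\<^sub>R w)"
  shows "z \<bullet> w = 0"
proof (cases "w = 0")
  case False
  define s where "s = - (z \<bullet> w) / (w \<bullet> w)"
  have ww: "w \<bullet> w > 0" using False by simp
  have "(norm z)\<^sup>2 \<le> (norm (z + s *\<^sub>R w))\<^sup>2"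
    by (intro power_mono assms) simp
  also have "\<dots> = (norm z)\<^sup>2 + 2 * s * (z \<bullet> w) + s * s * (w \<bullet> w)"
    by (simp add: power2_norm_eq_inner inner_add_left inner_add_right inner_commute algebra_simps)
  also have "\<dots> = (norm z)\<^sup>2 - (z \<bullet> w)\<^sup>2 / (w \<bullet> w)"
    using ww by (simp add: s_def field_simps power2_eq_square)
  finally have "(z \<bullet> w)\<^sup>2 / (w \<bullet> w) \<le> 0" by simp
  then show ?thesis using ww by (simp add: divide_le_0_iff)
qed simp

text \<open>
  If \<open>I - Q\<close> does not increase norms, then adding to \<open>b - Q b\<close> an element of the range of \<open>Q\<close>, which
  \<open>I - Q\<close> kills, cannot shorten it; so the two are orthogonal.
\<close>

lemma projector_orthogonalI:
  fixes Q :: "'a::euclidean_space \<Rightarrow> 'a"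
  assumes "linear Q" and idem: "\<And>u. Q (Q u) = Q u" and le: "\<And>u. norm (u - Q u) \<le> norm u"
  shows "orthogonal_projector Q"
proof -
  interpret Q: linear Q by (rule assms(1))
  have orth: "(b - Q b) \<bullet> Q a = 0" for a b
  proof (rule orthogonal_if_norm_minimal)
    fix s
    show "norm (b - Q b) \<le> norm (b - Q b + s *\<^sub>R Q a)"
      using le[of "b - Q b + s *\<^sub>R Q a"] by (simp add: Q.add Q.diff Q.scale idem)
  qed
  have eq: "b \<bullet> Q a = Q b \<bullet> Q a" for a b
    using orth[of b a] by (simp add: inner_diff_left)
  have "Q a \<bullet> b = a \<bullet> Q b" for a b
    by (metis eq inner_commute)
  then show ?thesis
    using assms(1) idem by (simp add: orthogonal_projector_def)
qed

lemma projection_defined_onD: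
  assumes "projection_defined_on U D" "y \<in> U"
  shows "closest_point D y \<in> D" "w \<in> D \<Longrightarrow> dist y (closest_point D y) \<le> dist y w"
proof -
  obtain z where "z \<in> D \<and> (\<forall>w\<in>D. dist y z \<le> dist y w)"
    using assms by (auto simp: projection_defined_on_def)
  then have "closest_point D y \<in> D \<and> (\<forall>w\<in>D. dist y (closest_point D y) \<le> dist y w)"
    unfolding closest_point_def by (rule someI)
  then show "closest_point D y \<in> D" "w \<in> D \<Longrightarrow> dist y (closest_point D y) \<le> dist y w"
    by auto
qed

lemma dist_closest_point_eq_infdist:
  assumes "projection_defined_on U D" "y \<in> U"
  shows "dist y (closest_point D y) = infdist y D"
  using norm_diff_closest_point_eq_infdist projection_defined_onD[OF assms]
  by (metis dist_norm)

lemma Ck1_differentiable: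
  "Ck1 (Suc k) S f \<Longrightarrow> x \<in> S \<Longrightarrow> f differentiable (at x)"
  by (simp add: Ck1_def)

lemma Ck1_frechet_derivative_differentiable:
  "Ck1 (Suc (Suc k)) S f \<Longrightarrow> x \<in> S \<Longrightarrow> (\<lambda>x. frechet_derivative f (at x) v) differentiable (at x)"
  by (simp add: Ck1_def)

lemma Ck_isCont:
  assumes "Ck (Suc k) S f" "x \<in> S"
  shows "isCont f x"
  using assms by (auto simp: Ck_def intro: differentiable_imp_continuous_within)

text \<open>
  Smoothness of the projection onto \<open>D\<close> replaces charts: the curves \<open>t \<mapsto> P\<^sub>D(x + t v)\<close>
  provide all tangent vectors, so that the derivative \<open>DP x\<close> of the projection at \<open>x \<in> D\<close> is the
  orthogonal projector onto the tangent space.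
\<close>

locale smooth_projection =
  fixes U D :: "'a::euclidean_space set" and k :: nat
  assumes open_U: "open U"
    and defined: "projection_defined_on U D"
    and smooth: "Ck1 (Suc (Suc k)) U (closest_point D)"
begin

abbreviation DP :: "'a \<Rightarrow> 'a \<Rightarrow> 'a" where
  "DP x \<equiv> frechet_derivative (closest_point D) (at x)"

lemma has_derivative_projection:
  "x \<in> U \<Longrightarrow> (closest_point D has_derivative DP x) (at x)"
  using Ck1_differentiable[OF smooth] by (simp add: frechet_derivative_works)

lemma linear_DP: "x \<in> U \<Longrightarrow> linear (DP x)"
  using has_derivative_projection has_derivative_linear by blast

text \<open>
  A curve in \<open>D\<close> is unchanged by the projection onto \<open>D\<close>; differentiate this identity.
\<close>

lemma tangent_imp_DP_fixed:
  assumes x: "x \<in> D" "x \<in> U" and v: "v \<in> tangent_space D x"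
  shows "DP x v = v"
proof -
  obtain e c where e: "0 < e" and c: "c ` {-e<..<e::real} \<subseteq> D" "c 0 = x"
    and dc: "(c has_vector_derivative v) (at 0)"
    using v by (auto simp: tangent_space_def)
  have dc': "(c has_derivative (\<lambda>t. t *\<^sub>R v)) (at 0)"
    using dc by (simp add: has_vector_derivative_def)
  have "(closest_point D has_derivative DP x) (at (c 0))"
    using has_derivative_projection[OF x(2)] c(2) by simp
  from diff_chain_at[OF dc' this]
  have "(closest_point D \<circ> c has_derivative DP x \<circ> (\<lambda>t. t *\<^sub>R v)) (at 0)" .
  then have "(c has_derivative DP x \<circ> (\<lambda>t. t *\<^sub>R v)) (at 0)"
  proof (rule has_derivative_transform_within_open[where s = "{-e<..<e}"])
    show "(closest_point D \<circ> c) t = c t" if "t \<in> {-e<..<e}" for t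
      using c(1) that by (auto intro!: closest_point_self)
  qed (use e in auto)
  from fun_cong[OF has_derivative_unique[OF this dc'], of 1]
  show ?thesis by simp
qed

lemma DP_tangent:
  assumes x: "x \<in> D" "x \<in> U"
  shows "DP x v \<in> tangent_space D x"
proof -
  obtain r where r: "0 < r" "ball x r \<subseteq> U"
    using open_U x(2) open_contains_ball by blast
  define e where "e = r / (norm v + 1)"
  have e: "0 < e" using r by (simp add: e_def add_nonneg_pos)
  define c where "c = (\<lambda>t. closest_point D (x + t *\<^sub>R v))"
  have inU: "x + t *\<^sub>R v \<in> U" if "t \<in> {-e<..<e}" for t
  proof -
    have "norm (t *\<^sub>R v) \<le> \<bar>t\<bar> * (norm v + 1)" by (simp add: algebra_simps)
    also have "\<dots> < e * (norm v + 1)"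
      using that by (intro mult_strict_right_mono) (auto simp: add_nonneg_pos)
    also have "\<dots> = r"
      by (simp add: e_def add_nonneg_eq_0_iff)
    finally show ?thesis using r(2) by (auto simp: dist_norm)
  qed
  have dc: "(c has_vector_derivative DP (x + t *\<^sub>R v) v) (at t)" if "t \<in> {-e<..<e}" for t
  proof -
    have "((\<lambda>t. x + t *\<^sub>R v) has_derivative (\<lambda>s. s *\<^sub>R v)) (at t)"
      by (auto intro!: derivative_eq_intros)
    from diff_chain_at[OF this has_derivative_projection[OF inU[OF that]]]
    show ?thesis
      using linear_DP[OF inU[OF that]]
      by (simp add: has_vector_derivative_def c_def o_def linear_scale)
  qed
  have "Ck 1 {-e<..<e} c"
    unfolding Ck_def One_nat_def iterated_diff.simps
  proof (intro conjI ballI allI)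
    show "c differentiable (at t)" if "t \<in> {-e<..<e}" for t
      using dc[OF that] by (auto simp: has_vector_derivative_def differentiable_def)
    fix s
    have DPc: "continuous_on U (\<lambda>x. DP x v)"
    proof (rule continuous_at_imp_continuous_on, rule ballI)
      fix y assume "y \<in> U"
      from Ck1_frechet_derivative_differentiable[OF smooth this]
      show "isCont (\<lambda>x. DP x v) y" by (rule differentiable_imp_continuous_within)
    qed
    have line: "continuous_on {-e<..<e} (\<lambda>t. x + t *\<^sub>R v)"
      by (intro continuous_intros)
    have "continuous_on {-e<..<e} (\<lambda>t. DP (x + t *\<^sub>R v) v)"
      by (rule continuous_on_compose2[OF DPc line]) (use inU in blast)
    then have cont: "continuous_on {-e<..<e} (\<lambda>t. s *\<^sub>R DP (x + t *\<^sub>R v) v)"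
      by (intro continuous_intros)
    have eq: "frechet_derivative c (at t) s = s *\<^sub>R DP (x + t *\<^sub>R v) v"
      if "t \<in> {-e<..<e}" for t
      using frechet_derivative_at[OF dc[OF that, unfolded has_vector_derivative_def]]
      by (rule fun_cong[symmetric])
    show "continuous_on {-e<..<e} (\<lambda>t. frechet_derivative c (at t) s)"
      by (rule iffD2[OF continuous_on_cong[OF refl eq] cont])
  qed
  moreover have "c ` {-e<..<e} \<subseteq> D"
    using projection_defined_onD(1)[OF defined inU] by (auto simp: c_def)
  moreover have "c 0 = x" using x(1) by (simp add: c_def closest_point_self)
  moreover have "(c has_vector_derivative DP x v) (at 0)" using dc[of 0] e by simp
  ultimately have "Ck 1 {-e<..<e} c \<and> c ` {-e<..<e} \<subseteq> D \<and> c 0 = x \<and>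
      (c has_vector_derivative DP x v) (at 0)" by simp
  then have "\<exists>e>0. \<exists>c. Ck 1 {-e<..<e::real} c \<and> c ` {-e<..<e} \<subseteq> D \<and> c 0 = x \<and>
      (c has_vector_derivative DP x v) (at 0)" using e by (intro exI[of _ e] conjI exI[of _ c]) simp_all
  then show ?thesis unfolding tangent_space_def by simp
qed

lemma tangent_space_eq_DP_fixed:
  assumes "x \<in> D" "x \<in> U"
  shows "tangent_space D x = {v. DP x v = v}"
proof (intro set_eqI iffI)
  fix v assume "v \<in> {v. DP x v = v}"
  then show "v \<in> tangent_space D x" using DP_tangent[OF assms, of v] by simp
qed (simp add: tangent_imp_DP_fixed[OF assms])

text \<open>
  \<open>x\<close> itself competes with the nearest point to \<open>x + t u\<close>, so \<open>dist (x + t u) D \<le> t \<parallel>u\<parallel>\<close>;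
  divide by \<open>t\<close> and let \<open>t \<rightarrow> 0\<close>.
\<close>

lemma norm_diff_DP_le:
  assumes x: "x \<in> D" "x \<in> U"
  shows "norm (u - DP x u) \<le> norm u"
proof (rule field_le_epsilon)
  fix e :: real assume e: "0 < e"
  interpret Q: linear "DP x" by (rule linear_DP[OF x(2)])
  define e' where "e' = e / (norm u + 1)"
  have e': "0 < e'" using e by (simp add: e'_def add_nonneg_pos)
  have "e' * norm u \<le> e' * (norm u + 1)" using e' by simp
  also have "\<dots> = e" by (simp add: e'_def add_nonneg_eq_0_iff)
  finally have e'e: "e' * norm u \<le> e" .
  obtain d where d: "0 < d"
    "\<And>y. norm (y - x) < d \<Longrightarrow> norm (closest_point D y - closest_point D x - DP x (y - x)) \<le> e' * norm (y - x)"
    using has_derivative_projection[OF x(2)] e' unfolding has_derivative_at_alt by blast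
  obtain r where r: "0 < r" "ball x r \<subseteq> U"
    using open_U x(2) open_contains_ball by blast
  define t where "t = min d r / (2 * (norm u + 1))"
  have t: "0 < t" using d r by (simp add: t_def add_nonneg_pos)
  have "t * norm u < t * (2 * (norm u + 1))"
    using t by (intro mult_strict_left_mono) (auto simp: add_nonneg_pos)
  also have "\<dots> = min d r" by (simp add: t_def add_nonneg_eq_0_iff)
  finally have tu: "t * norm u < min d r" .
  let ?y = "x + t *\<^sub>R u"
  have yU: "?y \<in> U" using r tu t by (auto simp: dist_norm subset_eq)
  have a: "norm (?y - closest_point D ?y) \<le> t * norm u"
    using projection_defined_onD(2)[OF defined yU x(1)] t by (simp add: dist_norm)
  have b: "norm (closest_point D ?y - x - t *\<^sub>R DP x u) \<le> e' * (t * norm u)"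
    using d(2)[of ?y] tu t x(1) by (simp add: closest_point_self Q.scale)
  have "t * norm (u - DP x u) = norm ((?y - closest_point D ?y) + (closest_point D ?y - x - t *\<^sub>R DP x u))"
    using t by (simp add: algebra_simps flip: scaleR_diff_right)
  also have "\<dots> \<le> t * norm u + e' * (t * norm u)"
    using a b by (intro norm_triangle_le) simp
  also have "\<dots> = t * (norm u + e' * norm u)" by (simp add: algebra_simps)
  also have "\<dots> \<le> t * (norm u + e)" using t e'e by simp
  finally show "norm (u - DP x u) \<le> norm u + e" using t by simp
qed

proposition orthogonal_projector_DP:
  assumes x: "x \<in> D" "x \<in> U"
  shows "orthogonal_projector (DP x)"
  using tangent_imp_DP_fixed[OF x DP_tangent[OF x]] linear_DP[OF x(2)] norm_diff_DP_le[OF x]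
  by (intro projector_orthogonalI) auto

corollary closest_point_tangent_space:
  assumes x: "x \<in> D" "x \<in> U"
  shows "closest_point (tangent_space D x) u = DP x u"
  by (simp only: tangent_space_eq_DP_fixed[OF x]
      closest_point_orthogonal_projector[OF orthogonal_projector_DP[OF x]])

text \<open>
  Consistency bounds \<open>\<phi> - P\<^sub>D\<close> by \<open>o(dist y D)\<close>, which is \<open>o(\<parallel>y - x\<parallel>)\<close> for \<open>x \<in> D\<close>.
\<close>

lemma first_order_consistent_derivative:
  assumes x: "x \<in> D" "x \<in> U" "x \<in> V" and cont: "isCont \<phi> x"
    and foc: "first_order_consistent V \<phi> D"
  shows "\<phi> x = x" "(\<phi> has_derivative DP x) (at x)"
proof -
  let ?f = "\<lambda>y. \<phi> y - closest_point D y"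
  have small: "\<forall>\<^sub>F y in at x. norm (?f y) \<le> e * norm (y - x)" if e: "0 < e" for e
  proof -
    have "(\<lambda>y. norm (?f y)) \<in> o[at x](\<lambda>y. infdist y D)"
      using foc x by (auto simp: first_order_consistent_def)
    from landau_o.smallD[OF this e]
    have "\<forall>\<^sub>F y in at x. norm (?f y) \<le> e * infdist y D"
      by (simp add: infdist_nonneg)
    then show ?thesis
    proof (rule eventually_mono)
      fix y assume "norm (?f y) \<le> e * infdist y D"
      also have "\<dots> \<le> e * norm (y - x)"
        using e infdist_le[OF x(1), of y] by (intro mult_left_mono) (auto simp: dist_norm)
      finally show "norm (?f y) \<le> e * norm (y - x)" .
    qed
  qed
  have contP: "isCont (closest_point D) x"
    using has_derivative_continuous[OF has_derivative_projection[OF x(2)]] .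
  have "(?f \<longlongrightarrow> 0) (at x)"
  proof (rule Lim_null_comparison[OF small[of 1]])
    show "((\<lambda>y. 1 * norm (y - x)) \<longlongrightarrow> 0) (at x)"
      by (auto intro!: tendsto_eq_intros)
  qed simp
  moreover have "(?f \<longlongrightarrow> \<phi> x - closest_point D x) (at x)"
    using cont contP by (intro tendsto_diff) (auto simp: isCont_def)
  ultimately have "\<phi> x - closest_point D x = 0"
    by (intro tendsto_unique[OF at_neq_bot])
  then show fx: "\<phi> x = x" using closest_point_self[OF x(1)] by simp
  have "(?f has_derivative (\<lambda>h. 0)) (at x)"
    unfolding has_derivative_at_alt
  proof (intro conjI allI impI)
    show "bounded_linear (\<lambda>h. 0)" by simp
    fix e :: real assume "0 < e"
    from small[OF this] obtain d where d: "0 < d"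
      "\<And>y. y \<noteq> x \<Longrightarrow> dist y x < d \<Longrightarrow> norm (?f y) \<le> e * norm (y - x)"
      by (auto simp: eventually_at)
    have "norm (?f y - ?f x - 0) \<le> e * norm (y - x)" if "norm (y - x) < d" for y
      using d(2)[of y] that fx closest_point_self[OF x(1)]
      by (cases "y = x") (auto simp: dist_norm)
    then show "\<exists>d>0. \<forall>y. norm (y - x) < d \<longrightarrow> norm (?f y - ?f x - 0) \<le> e * norm (y - x)"
      using d(1) by blast
  qed
  from has_derivative_add[OF this has_derivative_projection[OF x(2)]]
  show "(\<phi> has_derivative DP x) (at x)" by simp
qed

text \<open>
  For \<open>m\<close> in \<open>D\<close>, the operator \<open>D1 m - I\<close> vanishes on the tangent space at \<open>m\<close> and maps into the normal
  space. Hence, for \<open>w\<close> and \<open>b\<close> tangent at \<open>z\<close>,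
  \<open>w \<bullet> (D1 m - I) b = (w - DP m w) \<bullet> (D1 m - I) (b - DP m b)\<close>. Along a curve in \<open>D\<close> through
  \<open>z\<close> with velocity \<open>a\<close>, both outer factors vanish at \<open>z\<close>, so the right-hand side has derivative
  zero, while the derivative of the left-hand side is \<open>w \<bullet> D2 a b\<close>.
\<close>

lemma second_derivative_normal:
  fixes D1 :: "'a \<Rightarrow> 'a \<Rightarrow>\<^sub>L 'a" and D2 :: "'a \<Rightarrow>\<^sub>L 'a \<Rightarrow>\<^sub>L 'a"
  assumes G: "open G" "G \<subseteq> U" and z: "z \<in> D" "z \<in> G"
    and D2: "(D1 has_derivative blinfun_apply D2) (at z)"
    and fix1: "\<And>m u. m \<in> D \<Longrightarrow> m \<in> G \<Longrightarrow> blinfun_apply (D1 m) (DP m u) = DP m u"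
    and fix2: "\<And>m u. m \<in> D \<Longrightarrow> m \<in> G \<Longrightarrow> DP m (blinfun_apply (D1 m) u) = DP m u"
    and a: "DP z a = a" and b: "DP z b = b"
  shows "DP z (blinfun_apply (blinfun_apply D2 a) b) = 0"
proof -
  have zU: "z \<in> U" using G z by blast
  have proj: "orthogonal_projector (DP m)" if "m \<in> D" "m \<in> G" for m
    using orthogonal_projector_DP that G by blast
  define m where "m = (\<lambda>t. closest_point D (z + t *\<^sub>R a))"
  have m0: "m 0 = z" by (simp add: m_def closest_point_self z)
  have line: "((\<lambda>t. z + t *\<^sub>R a) has_derivative (\<lambda>s. s *\<^sub>R a)) (at 0)"
    by (auto intro!: derivative_eq_intros)
  have "(closest_point D has_derivative DP z) (at (z + 0 *\<^sub>R a))"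
    using has_derivative_projection[OF zU] by simp
  from diff_chain_at[OF line this]
  have dm: "(m has_derivative (\<lambda>s. s *\<^sub>R a)) (at 0)"
    using linear_DP[OF zU] by (simp add: m_def o_def linear_scale a)
  have "isCont m 0" using has_derivative_continuous[OF dm] .
  then have evG: "\<forall>\<^sub>F t in nhds 0. m t \<in> G"
    using topological_tendstoD[of m "m 0" "nhds 0" G] z m0 G
    by (auto simp: continuous_within tendsto_at_iff_tendsto_nhds)
  have evU: "\<forall>\<^sub>F t in nhds 0. z + t *\<^sub>R a \<in> U"
  proof -
    have "((\<lambda>t. z + t *\<^sub>R a) \<longlongrightarrow> z + 0 *\<^sub>R a) (nhds 0)"
      by (intro tendsto_intros filterlim_ident)
    from topological_tendstoD[OF this open_U] show ?thesis using zU by simp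
  qed
  have evD: "\<forall>\<^sub>F t in nhds 0. m t \<in> D \<and> m t \<in> G"
    using evG evU by eventually_elim (auto simp: m_def projection_defined_onD(1)[OF defined])
  have dD1: "((\<lambda>t. D1 (m t)) has_derivative (\<lambda>s. blinfun_apply D2 (s *\<^sub>R a))) (at 0)"
    using diff_chain_at[OF dm] D2 m0 by (simp add: o_def)
  have dDP: "\<exists>q. ((\<lambda>t. DP (m t) c) has_derivative q) (at 0)" for c
  proof -
    have "(\<lambda>x. DP x c) differentiable (at (m 0))"
      using Ck1_frechet_derivative_differentiable[OF smooth zU] m0 by simp
    then obtain q where "((\<lambda>x. DP x c) has_derivative q) (at (m 0))"
      by (auto simp: differentiable_def)
    from diff_chain_at[OF dm this] show ?thesis by (auto simp: o_def)
  qed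
  have key: "w \<bullet> blinfun_apply (blinfun_apply D2 a) b = 0" if w: "DP z w = w" for w
  proof -
    obtain p where p: "((\<lambda>t. DP (m t) w) has_derivative p) (at 0)" using dDP by blast
    obtain q where q: "((\<lambda>t. DP (m t) b) has_derivative q) (at 0)" using dDP by blast
    have dg: "((\<lambda>t. w - DP (m t) w) has_derivative (\<lambda>s. 0 - p s)) (at 0)"
      by (intro has_derivative_diff has_derivative_const p)
    have dk: "((\<lambda>t. b - DP (m t) b) has_derivative (\<lambda>s. 0 - q s)) (at 0)"
      by (intro has_derivative_diff has_derivative_const q)
    note dX = has_derivative_diff[OF bounded_bilinear.FDERIV[OF bounded_bilinear_blinfun_apply dD1 dk] dk]
    note dh = has_derivative_inner[OF dg dX]
    have lhs: "((\<lambda>t. w \<bullet> (blinfun_apply (D1 (m t)) b - b)) has_derivative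
        (\<lambda>s. w \<bullet> blinfun_apply (blinfun_apply D2 (s *\<^sub>R a)) b)) (at 0)"
      using has_derivative_inner_right[OF has_derivative_diff[OF
          bounded_bilinear.FDERIV[OF bounded_bilinear_blinfun_apply dD1 has_derivative_const[of b]]
          has_derivative_const[of b]], of w]
      by (simp add: blinfun.zero_right)
    have "((\<lambda>t. w \<bullet> (blinfun_apply (D1 (m t)) b - b)) has_derivative (\<lambda>s. 0)) (at 0)"
    proof -
      have zero: "((\<lambda>t. (w - DP (m t) w) \<bullet>
            (blinfun_apply (D1 (m t)) (b - DP (m t) b) - (b - DP (m t) b)))
          has_derivative (\<lambda>s. 0)) (at 0)"
        using dh by (simp add: m0 w b blinfun.zero_right)
      have ev: "\<forall>\<^sub>F t in nhds 0. (w - DP (m t) w) \<bullet>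
            (blinfun_apply (D1 (m t)) (b - DP (m t) b) - (b - DP (m t) b))
          = w \<bullet> (blinfun_apply (D1 (m t)) b - b)"
        using evD
      proof eventually_elim
        case (elim t)
        let ?Q = "DP (m t)" and ?A = "blinfun_apply (D1 (m t))"
        note pr = orthogonal_projectorD[OF proj[of "m t"]]
        interpret Q: linear ?Q using elim by (intro pr(1)) auto
        have X: "?A (b - ?Q b) - (b - ?Q b) = ?A b - b"
          using fix1[of "m t"] elim by (simp add: blinfun.diff_right)
        have "?Q (?A b - b) = 0" using fix2[of "m t"] elim by (simp add: Q.diff)
        then have "?Q w \<bullet> (?A b - b) = 0" using pr(3) elim by simp
        then show ?case unfolding X by (simp add: inner_diff_left)
      qed
      show ?thesis
      proof (rule has_derivative_transform_eventually[OF zero])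
        show "\<forall>\<^sub>F t in at 0. (w - DP (m t) w) \<bullet>
            (blinfun_apply (D1 (m t)) (b - DP (m t) b) - (b - DP (m t) b))
          = w \<bullet> (blinfun_apply (D1 (m t)) b - b)"
          using ev unfolding eventually_at_filter by (rule eventually_mono) simp
      qed (use eventually_nhds_x_imp_x[OF ev] in simp_all)
    qed
    from fun_cong[OF has_derivative_unique[OF lhs this], of 1] show ?thesis by simp
  qed
  let ?u = "blinfun_apply (blinfun_apply D2 a) b"
  note prz = orthogonal_projectorD[OF proj[OF z]]
  have "DP z ?u \<bullet> DP z ?u = DP z (DP z ?u) \<bullet> ?u"
    by (simp only: prz(3))
  also have "\<dots> = 0" using key[of "DP z ?u"] prz(2) by simp
  finally show ?thesis by simp
qed

end


section \<open>Convergence of orbits\<close>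

text \<open>
  In \<open>M1\<close>, the length of a step of \<open>\<phi>\<close> is controlled by the distance to the fixed points
  \<open>M\<close>, hence by the distance to \<open>M2\<close>, which decays geometrically. So the length of an orbit from its first iterate
  on is at most a multiple of the distance of this iterate to \<open>M2\<close>, and an orbit that starts close to \<open>x\<close>
  remains in the ball and converges.
\<close>

lemma orbit_converges:
  fixes \<phi> :: "'a::euclidean_space \<Rightarrow> 'a"
  assumes const: "0 < \<epsilon>" "0 \<le> L" "0 \<le> \<kappa>" "0 < \<tau>" "\<tau> < 1" "r \<le> \<epsilon> / 4"
      "L * r + (L + 1) * \<kappa> * (L * r) / (1 - \<tau>) \<le> \<epsilon> / 4"
    and x: "x \<in> M" "M \<subseteq> M2"
    and lip: "\<And>y y'. y \<in> ball x \<epsilon> \<Longrightarrow> y' \<in> ball x \<epsilon> \<Longrightarrow> norm (\<phi> y - \<phi> y') \<le> L * norm (y - y')"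
    and fixed: "\<And>m. m \<in> M \<Longrightarrow> m \<in> ball x \<epsilon> \<Longrightarrow> \<phi> m = m"
    and into: "\<And>y. y \<in> ball x \<epsilon> \<Longrightarrow> \<phi> y \<in> M1"
    and decay: "\<And>y. y \<in> M1 \<Longrightarrow> y \<in> ball x \<epsilon> \<Longrightarrow> infdist (\<phi> y) M2 \<le> \<tau> * infdist y M2"
    and regular: "\<And>y. y \<in> M1 \<Longrightarrow> y \<in> ball x \<epsilon> \<Longrightarrow> infdist y M \<le> \<kappa> * infdist y M2"
    and nearest: "\<And>y. y \<in> ball x \<epsilon> \<Longrightarrow> \<exists>m\<in>M. dist y m = infdist y M"
    and y: "y \<in> ball x r"
  shows "(\<phi> ^^ k) y \<in> ball x \<epsilon>"
    and "\<exists>z\<in>M \<inter> ball x \<epsilon>. (\<lambda>k. (\<phi> ^^ k) y) \<longlonglongrightarrow> z \<and> (\<forall>k. norm ((\<phi> ^^ k) y - z) \<le> \<epsilon> / \<tau> * \<tau> ^ k)"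
proof -
  define X where "X = (\<lambda>k. (\<phi> ^^ Suc k) y)"
  define s where "s = L * r"
  define b where "b = (L + 1) * \<kappa> * s"
  have r0: "0 < r" using y by (auto simp: dist_commute intro: le_less_trans[OF zero_le_dist])
  have s0: "0 \<le> s" using const r0 by (simp add: s_def)
  have b0: "0 \<le> b" using const s0 by (simp add: b_def)
  have sb: "s + b / (1 - \<tau>) \<le> \<epsilon> / 4"
    using const(7) by (simp add: s_def b_def)
  have step: "norm (\<phi> u - u) \<le> (L + 1) * infdist u M" if u: "u \<in> ball x (\<epsilon> / 2)" for u
  proof -
    have u': "u \<in> ball x \<epsilon>" using u const(1) by auto
    then obtain m where m: "m \<in> M" "dist u m = infdist u M" using nearest by blast
    have "dist u m \<le> dist u x" using m infdist_le[OF x(1), of u] by simp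
    moreover have "dist x m \<le> dist x u + dist u m" by (rule dist_triangle)
    ultimately have mb: "m \<in> ball x \<epsilon>" using u by (simp add: dist_commute)
    have "norm (\<phi> u - u) \<le> norm (\<phi> u - \<phi> m) + norm (m - u)"
      using fixed[OF m(1) mb] norm_triangle_ineq[of "\<phi> u - \<phi> m" "m - u"] by simp
    also have "\<dots> \<le> L * norm (u - m) + norm (u - m)"
      using lip[OF u' mb] by (simp add: norm_minus_commute)
    also have "\<dots> = (L + 1) * infdist u M"
      using m(2) by (simp add: dist_norm algebra_simps)
    finally show ?thesis .
  qed
  have geo: "(\<Sum>j<k. \<tau> ^ j) \<le> 1 / (1 - \<tau>)" for k
  proof -
    have "(\<Sum>j<k. \<tau> ^ j) \<le> (\<Sum>j. \<tau> ^ j)"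
      using const by (intro sum_le_suminf summable_geometric) auto
    then show ?thesis using const by (simp add: suminf_geometric)
  qed
  have small: "s + b * (\<Sum>j<k. \<tau> ^ j) \<le> \<epsilon> / 4" for k
  proof -
    have "b * (\<Sum>j<k. \<tau> ^ j) \<le> b / (1 - \<tau>)"
      using mult_left_mono[OF geo b0] by simp
    then show ?thesis using sb by linarith
  qed
  \<comment> \<open>The bounds are started at the first iterate, because \<open>y\<close> itself need not lie in \<open>M1\<close>.\<close>
  have inv: "X k \<in> M1 \<and> infdist (X k) M2 \<le> s * \<tau> ^ k \<and> dist x (X k) \<le> s + b * (\<Sum>j<k. \<tau> ^ j)
      \<and> norm (X (Suc k) - X k) \<le> b * \<tau> ^ k" for k
  proof -
    have steps: "norm (X (Suc k) - X k) \<le> b * \<tau> ^ k"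
      if 1: "X k \<in> M1" and 2: "infdist (X k) M2 \<le> s * \<tau> ^ k"
        and 3: "dist x (X k) \<le> s + b * (\<Sum>j<k. \<tau> ^ j)" for k
    proof -
      have half: "X k \<in> ball x (\<epsilon> / 2)" "X k \<in> ball x \<epsilon>"
        using 3 small[of k] const(1) by auto
      have "norm (X (Suc k) - X k) \<le> (L + 1) * infdist (X k) M"
        using step[OF half(1)] by (simp add: X_def)
      also have "\<dots> \<le> (L + 1) * (\<kappa> * (s * \<tau> ^ k))"
        using const 2 order_trans[OF regular[OF 1 half(2)] mult_left_mono[OF 2 const(3)]]
        by (intro mult_left_mono) auto
      finally show ?thesis by (simp add: b_def mult_ac)
    qed
    show ?thesis
    proof (induction k)
      case 0
      have yb: "y \<in> ball x \<epsilon>" using y const by auto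
      have xb: "x \<in> ball x \<epsilon>" using const by simp
      have "norm (\<phi> y - \<phi> x) \<le> L * norm (y - x)" by (rule lip[OF yb xb])
      also have "\<dots> \<le> s"
        unfolding s_def using y const by (intro mult_left_mono) (auto simp: dist_norm norm_minus_commute)
      finally have d: "dist x (X 0) \<le> s"
        using fixed[OF x(1) xb] by (simp add: X_def dist_norm norm_minus_commute)
      have "infdist (X 0) M2 \<le> s"
        using infdist_le[of x M2 "X 0"] x d by (auto simp: dist_commute)
      moreover have "X 0 \<in> M1" using into[OF yb] by (simp add: X_def)
      ultimately show ?case using d steps[of 0] by simp
    next
      case (Suc k)
      then have 1: "X k \<in> M1" and 2: "infdist (X k) M2 \<le> s * \<tau> ^ k"
        and 3: "dist x (X k) \<le> s + b * (\<Sum>j<k. \<tau> ^ j)" and 4: "norm (X (Suc k) - X k) \<le> b * \<tau> ^ k"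
        by auto
      have kb: "X k \<in> ball x \<epsilon>" using 3 small[of k] const(1) by auto
      have S1: "X (Suc k) \<in> M1" using into[OF kb] by (simp add: X_def)
      have "infdist (X (Suc k)) M2 \<le> \<tau> * infdist (X k) M2"
        using decay[OF 1 kb] by (simp add: X_def)
      also have "\<dots> \<le> \<tau> * (s * \<tau> ^ k)" using 2 const by (intro mult_left_mono) auto
      finally have S2: "infdist (X (Suc k)) M2 \<le> s * \<tau> ^ Suc k" by (simp add: mult_ac)
      have "dist x (X (Suc k)) \<le> dist x (X k) + dist (X k) (X (Suc k))" by (rule dist_triangle)
      also have "\<dots> \<le> s + b * (\<Sum>j<k. \<tau> ^ j) + b * \<tau> ^ k"
        using 3 4 by (intro add_mono) (simp_all add: dist_norm norm_minus_commute)
      finally have S3: "dist x (X (Suc k)) \<le> s + b * (\<Sum>j<Suc k. \<tau> ^ j)"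
        by (simp add: algebra_simps)
      show ?case using S1 S2 S3 steps[OF S1 S2 S3] by blast
    qed
  qed
  have quarter: "dist x (X k) \<le> \<epsilon> / 4" for k
    using inv[of k] small[of k] by linarith
  show orbit: "(\<phi> ^^ k) y \<in> ball x \<epsilon>" for k
  proof (cases k)
    case 0 then show ?thesis using y const by auto
  next
    case (Suc j) then show ?thesis using quarter[of j] const(1) by (simp add: X_def)
  qed
  let ?z = "lim X"
  have \<tau>0: "0 \<le> \<tau>" using const by simp
  have "norm (X (Suc k) - X k) \<le> b * \<tau> ^ k" for k using inv by blast
  note lim = geometric_steps_limit[OF this \<tau>0 const(5)]
  have "dist x ?z \<le> \<epsilon> / 4"
    by (rule LIMSEQ_le_const2[OF tendsto_dist[OF tendsto_const lim(1)]]) (use quarter in blast)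
  then have zb: "?z \<in> ball x \<epsilon>" "dist x ?z \<le> \<epsilon> / 4" using const(1) by auto
  have "infdist (X k) M \<le> \<kappa> * (s * \<tau> ^ k)" for k
  proof -
    have "X k \<in> ball x \<epsilon>" using quarter[of k] const(1) by auto
    then show ?thesis
      using inv[of k] order_trans[OF regular mult_left_mono[OF _ const(3)]] by blast
  qed
  moreover have "(\<lambda>k. \<kappa> * (s * \<tau> ^ k)) \<longlonglongrightarrow> 0"
    using const LIMSEQ_power_zero[of \<tau>] by (intro tendsto_mult_right_zero) auto
  moreover have "(\<lambda>k. infdist (X k) M) \<longlonglongrightarrow> infdist ?z M"
    by (rule tendsto_infdist[OF lim(1)])
  ultimately have "infdist ?z M \<le> 0"
    using LIMSEQ_le by blast
  then have iz: "infdist ?z M = 0" using infdist_nonneg[of ?z M] by linarith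
  obtain m where "m \<in> M" "dist ?z m = infdist ?z M" using nearest[OF zb(1)] by blast
  then have zM: "?z \<in> M" using iz by simp
  have conv: "(\<lambda>k. (\<phi> ^^ k) y) \<longlonglongrightarrow> ?z"
    using lim(1) unfolding X_def by (rule LIMSEQ_imp_Suc)
  \<comment> \<open>The factor \<open>1 / \<tau>\<close> makes up for the shift by one between \<open>X\<close> and the orbit of \<open>y\<close>.\<close>
  have rate: "norm ((\<phi> ^^ k) y - ?z) \<le> \<epsilon> / \<tau> * \<tau> ^ k" for k
  proof (cases k)
    case 0
    have "norm (y - ?z) \<le> dist x y + dist x ?z"
      by (metis dist_norm dist_triangle2 dist_commute)
    also have "\<dots> \<le> \<epsilon>" using y zb(2) const by auto
    also have "\<dots> \<le> \<epsilon> / \<tau>" using const by (simp add: field_simps)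
    finally show ?thesis using 0 by simp
  next
    case (Suc j)
    have "norm ((\<phi> ^^ k) y - ?z) \<le> b / (1 - \<tau>) * \<tau> ^ j"
      using lim(2)[of j] Suc by (simp add: X_def)
    also have "\<dots> \<le> \<epsilon> * \<tau> ^ j"
    proof (rule mult_right_mono)
      show "b / (1 - \<tau>) \<le> \<epsilon>" using sb s0 const(1) by linarith
    qed (use const in simp)
    finally show ?thesis using Suc const by simp
  qed
  show "\<exists>z\<in>M \<inter> ball x \<epsilon>. (\<lambda>k. (\<phi> ^^ k) y) \<longlonglongrightarrow> z \<and> (\<forall>k. norm ((\<phi> ^^ k) y - z) \<le> \<epsilon> / \<tau> * \<tau> ^ k)"
    using zM zb(1) conv rate by blast
qed


section \<open>Classes of differentiability and Taylor estimates\<close>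

lemma differentiable_cong_open:
  assumes "open S" "x \<in> S" "\<And>y. y \<in> S \<Longrightarrow> f y = g y" "(g has_derivative g') (at x)"
  shows "(f has_derivative g') (at x)"
  using has_derivative_transform_within_open[OF assms(4,1,2)] assms(3) by simp

lemma Ck_2I:
  assumes S: "open S"
    and d1: "\<And>x. x \<in> S \<Longrightarrow> (f has_derivative d1 x) (at x)"
    and d2: "\<And>x v. x \<in> S \<Longrightarrow> ((\<lambda>x. d1 x v) has_derivative d2 x v) (at x)"
    and cont: "\<And>v w. continuous_on S (\<lambda>x. d2 x v w)"
  shows "Ck 2 S f"
proof -
  have eq1: "frechet_derivative f (at x) = d1 x" if "x \<in> S" for x
    using frechet_derivative_at[OF d1[OF that]] by simp
  have d2': "((\<lambda>x. frechet_derivative f (at x) v) has_derivative d2 x v) (at x)" if "x \<in> S" for x v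
    by (rule differentiable_cong_open[OF S that _ d2[OF that]]) (simp add: eq1)
  have eq2: "frechet_derivative (\<lambda>x. frechet_derivative f (at x) v) (at x) w = d2 x v w"
    if "x \<in> S" for x v w
    using frechet_derivative_at[OF d2'[OF that]] by simp
  have "continuous_on S (\<lambda>x. frechet_derivative (\<lambda>x. frechet_derivative f (at x) v) (at x) w)" for v w
    by (rule iffD2[OF continuous_on_cong[OF refl eq2] cont])
  moreover have "f differentiable (at x)" if "x \<in> S" for x
    using d1[OF that] by (rule differentiableI)
  moreover have "(\<lambda>x. frechet_derivative f (at x) v) differentiable (at x)" if "x \<in> S" for x v
    using d2'[OF that] by (rule differentiableI)
  ultimately show ?thesis
    unfolding Ck_def numeral_2_eq_2 iterated_diff.simps by blast
qed

text \<open>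
  Mean value inequality: \<open>f1 t = o(t)\<close>, and integrating gains one power of \<open>t\<close>.
\<close>

lemma smallo_square_if_flat:
  fixes f f1 :: "real \<Rightarrow> 'a::real_normed_vector"
  assumes e: "0 < e" and f: "\<And>t. \<bar>t\<bar> < e \<Longrightarrow> (f has_vector_derivative f1 t) (at t)"
    and zero: "f 0 = 0" "f1 0 = 0" and flat: "(f1 has_vector_derivative 0) (at 0)"
  shows "(\<lambda>t. norm (f t)) \<in> o[at 0](\<lambda>t. t\<^sup>2)"
proof (rule landau_o.smallI)
  fix c :: real assume c: "0 < c"
  obtain d where d: "0 < d" "\<And>t. \<bar>t\<bar> < d \<Longrightarrow> norm (f1 t) \<le> c * \<bar>t\<bar>"
    using flat c zero(2) unfolding has_vector_derivative_def has_derivative_at_alt by auto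
  have "norm (f t) \<le> c * t\<^sup>2" if t: "\<bar>t\<bar> < min d e" for t
  proof -
    have "norm (f t - f 0) \<le> (c * \<bar>t\<bar>) * norm (t - 0)"
    proof (rule differentiable_bound[where S = "cball (0::real) \<bar>t\<bar>"])
      show "convex (cball (0::real) \<bar>t\<bar>)" by (rule convex_cball)
      fix s :: real assume s: "s \<in> cball 0 \<bar>t\<bar>"
      then have s': "\<bar>s\<bar> \<le> \<bar>t\<bar>" by (simp add: dist_real_def)
      show "(f has_derivative (\<lambda>h. h *\<^sub>R f1 s)) (at s within cball 0 \<bar>t\<bar>)"
        using f[of s] s' t has_derivative_at_withinI by (auto simp: has_vector_derivative_def)
      have "norm (f1 s) \<le> c * \<bar>s\<bar>" using d(2)[of s] s' t by simp
      also have "\<dots> \<le> c * \<bar>t\<bar>" using s' c by simp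
      finally show "onorm (\<lambda>h. h *\<^sub>R f1 s) \<le> c * \<bar>t\<bar>"
        by (intro onorm_le) (simp add: mult.commute mult_left_mono)
    qed (auto simp: dist_real_def)
    then show ?thesis by (simp add: zero power2_eq_square mult.assoc)
  qed
  then have "\<forall>t. t \<noteq> 0 \<and> dist t 0 < min d e \<longrightarrow> norm (norm (f t)) \<le> c * norm (t\<^sup>2)"
    by (simp add: dist_real_def)
  then show "\<forall>\<^sub>F t in at 0. norm (norm (f t)) \<le> c * norm (t\<^sup>2)"
    unfolding eventually_at using d(1) e by (intro exI[of _ "min d e"]) auto
qed

lemma smallo_linear_if_has_vector_derivative:
  fixes g :: "real \<Rightarrow> 'a::real_normed_vector"
  assumes "(g has_vector_derivative v) (at 0)"
  shows "(\<lambda>t. norm (g t - (g 0 + t *\<^sub>R v))) \<in> o[at 0](\<lambda>t. t)"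
proof (rule landau_o.smallI)
  fix c :: real assume c: "0 < c"
  obtain d where "0 < d" "\<And>t. \<bar>t\<bar> < d \<Longrightarrow> norm (g t - g 0 - t *\<^sub>R v) \<le> c * \<bar>t\<bar>"
    using assms c unfolding has_vector_derivative_def has_derivative_at_alt by auto
  then show "\<forall>\<^sub>F t in at 0. norm (norm (g t - (g 0 + t *\<^sub>R v))) \<le> c * norm t"
    unfolding eventually_at by (intro exI[of _ d]) (simp add: dist_real_def diff_diff_eq)
qed


section \<open>Alternating maps near a clean intersection\<close>

text \<open>
  The derivatives \<open>D1\<close>, \<open>D2\<close> of \<open>\<phi>1 \<circ> \<phi>2\<close> and the constants are parameters, so that one choice of
  them serves all points of the compact set \<open>K\<close>.
\<close>

locale alternating_setting =
  S1: smooth_projection U M1 q + S2: smooth_projection U M2 q + SM: smooth_projection U M q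
  for U M1 M2 M :: "'a::euclidean_space set" and q :: nat +
  fixes W K :: "'a set" and \<phi>1 \<phi>2 :: "'a \<Rightarrow> 'a" and \<delta> \<tau> \<kappa> c \<Lambda> :: real
    and D1 :: "'a \<Rightarrow> 'a \<Rightarrow>\<^sub>L 'a" and D2 :: "'a \<Rightarrow> 'a \<Rightarrow>\<^sub>L 'a \<Rightarrow>\<^sub>L 'a"
  assumes M_eq: "M = M1 \<inter> M2"
    and W: "openin (top_of_set M) W"
    and tangent: "x \<in> W \<Longrightarrow> tangent_space M x = tangent_space M1 x \<inter> tangent_space M2 x"
    and angle: "x \<in> W \<Longrightarrow> onorm (\<lambda>u. closest_point (tangent_space M1 x) (closest_point (tangent_space M2 x) u)
                        - closest_point (tangent_space M x) u) \<le> c"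
    and c1: "c < 1"
    and \<kappa>: "0 < \<kappa>" "x \<in> M1 \<Longrightarrow> x \<in> U \<Longrightarrow> infdist x M \<le> \<kappa> * infdist x M2"
    and K: "compact K" "K \<noteq> {}" "K \<subseteq> W" "K \<subseteq> M"
    and \<delta>: "0 < \<delta>" "neighborhood \<delta> K \<subseteq> U"
    and \<tau>: "0 < \<tau>" "\<tau> < 1"
    and decay: "y \<in> M1 \<Longrightarrow> y \<in> neighborhood \<delta> K \<Longrightarrow> infdist ((\<phi>1 \<circ> \<phi>2) y) M2 \<le> \<tau> * infdist y M2"
    and framework: "x \<in> K \<Longrightarrow> \<exists>V. open V \<and> x \<in> V \<and> (\<forall>y\<in>V. isCont \<phi>1 y) \<and> (\<forall>y\<in>V. isCont \<phi>2 y) \<and> \<phi>1 ` V \<subseteq> M1 \<and>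
        ((\<forall>y\<in>V. \<phi>1 y = closest_point M1 y) \<or> first_order_consistent V \<phi>1 M1) \<and>
        ((\<forall>y\<in>V. \<phi>2 y = closest_point M2 y) \<or> first_order_consistent V \<phi>2 M2)"
    and D1: "y \<in> neighborhood \<delta> K \<Longrightarrow> ((\<phi>1 \<circ> \<phi>2) has_derivative blinfun_apply (D1 y)) (at y)"
    and D2: "y \<in> neighborhood \<delta> K \<Longrightarrow> (D1 has_derivative blinfun_apply (D2 y)) (at y)"
    and D2_lipschitz: "\<Lambda>-lipschitz_on (neighborhood \<delta> K) D2"
begin

abbreviation \<phi> where "\<phi> \<equiv> \<phi>1 \<circ> \<phi>2"

definition \<Phi> where "\<Phi> y = lim (\<lambda>k. (\<phi> ^^ k) y)"

lemma open_neighborhood: "open (neighborhood \<delta> K)"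
  unfolding neighborhood_def by (intro open_Collect_less continuous_intros)

text \<open>
  Whichever of the three alternatives of the framework holds, both maps fix the points of \<open>M\<close> and have there
  the derivatives of the projections onto \<open>M1\<close> and \<open>M2\<close>.
\<close>

lemma local_structure:
  assumes x: "x \<in> K"
  obtains G where "open G" "x \<in> G" "G \<subseteq> neighborhood \<delta> K" "M \<inter> G \<subseteq> W"
    "\<And>y. y \<in> G \<Longrightarrow> \<phi> y \<in> M1"
    "\<And>z. z \<in> M \<Longrightarrow> z \<in> G \<Longrightarrow> \<phi> z = z"
    "\<And>z u. z \<in> M \<Longrightarrow> z \<in> G \<Longrightarrow> blinfun_apply (D1 z) u = S1.DP z (S2.DP z u)"
proof -
  obtain V where V: "open V" "x \<in> V" "\<And>y. y \<in> V \<Longrightarrow> isCont \<phi>1 y" "\<And>y. y \<in> V \<Longrightarrow> isCont \<phi>2 y"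
      "\<phi>1 ` V \<subseteq> M1"
      "(\<forall>y\<in>V. \<phi>1 y = closest_point M1 y) \<or> first_order_consistent V \<phi>1 M1"
      "(\<forall>y\<in>V. \<phi>2 y = closest_point M2 y) \<or> first_order_consistent V \<phi>2 M2"
    using framework[OF x] by auto
  have 1: "\<phi>1 z = z \<and> (\<phi>1 has_derivative S1.DP z) (at z)" if z: "z \<in> M" "z \<in> V" "z \<in> U" for z
    using V(6)
  proof
    assume "\<forall>y\<in>V. \<phi>1 y = closest_point M1 y"
    then show ?thesis
      using z M_eq differentiable_cong_open[OF V(1) z(2) _ S1.has_derivative_projection[OF z(3)], of \<phi>1]
      by (simp add: closest_point_self)
  next
    assume "first_order_consistent V \<phi>1 M1"
    then show ?thesis
      using S1.first_order_consistent_derivative[of z V \<phi>1] z M_eq V(3) by blast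
  qed
  have 2: "\<phi>2 z = z \<and> (\<phi>2 has_derivative S2.DP z) (at z)" if z: "z \<in> M" "z \<in> V" "z \<in> U" for z
    using V(7)
  proof
    assume "\<forall>y\<in>V. \<phi>2 y = closest_point M2 y"
    then show ?thesis
      using z M_eq differentiable_cong_open[OF V(1) z(2) _ S2.has_derivative_projection[OF z(3)], of \<phi>2]
      by (simp add: closest_point_self)
  next
    assume "first_order_consistent V \<phi>2 M2"
    then show ?thesis
      using S2.first_order_consistent_derivative[of z V \<phi>2] z M_eq V(4) by blast
  qed
  obtain W' where W': "open W'" "W = M \<inter> W'" using W by (auto simp: openin_open)
  define G where "G = (V \<inter> \<phi>2 -` V) \<inter> neighborhood \<delta> K \<inter> W'"
  have cont2: "continuous_on V \<phi>2"
    using V(4) by (intro continuous_at_imp_continuous_on) blast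
  have xN: "x \<in> neighborhood \<delta> K"
    using x \<delta> by (simp add: neighborhood_def)
  have xM: "x \<in> M" "x \<in> W'" "x \<in> U" using x K W' xN \<delta> by auto
  show thesis
  proof (rule that[of G])
    show "open G" unfolding G_def
      by (rule open_Int[OF open_Int[OF continuous_open_preimage[OF cont2 V(1) V(1)] open_neighborhood] W'(1)])
    show "x \<in> G" using xM xN V(2) 2[of x] by (simp add: G_def)
    show "G \<subseteq> neighborhood \<delta> K" "M \<inter> G \<subseteq> W" using W' by (auto simp: G_def)
    show "\<phi> y \<in> M1" if "y \<in> G" for y using that V(5) by (auto simp: G_def)
    fix z assume z: "z \<in> M" "z \<in> G"
    then have zV: "z \<in> V" "z \<in> U" "z \<in> neighborhood \<delta> K" using \<delta> by (auto simp: G_def)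
    show fz: "\<phi> z = z" using 1[OF z(1) zV(1,2)] 2[OF z(1) zV(1,2)] by simp
    fix u
    have "(\<phi> has_derivative S1.DP z \<circ> S2.DP z) (at z)"
      using 1[OF z(1) zV(1,2)] 2[OF z(1) zV(1,2)] by (intro diff_chain_at) auto
    from fun_cong[OF has_derivative_unique[OF D1[OF zV(3)] this], of u]
    show "blinfun_apply (D1 z) u = S1.DP z (S2.DP z u)" by simp
  qed
qed

text \<open>
  The range of the projector for \<open>M\<close> is contained in the ranges of the other two, and all three are symmetric,
  so it absorbs their product on both sides.
\<close>

lemma projector_products:
  assumes z: "z \<in> M" "z \<in> W" "z \<in> U" and A: "\<And>u. A u = S1.DP z (S2.DP z u)"
  shows "orthogonal_projector (SM.DP z)" "A (SM.DP z u) = SM.DP z u" "SM.DP z (A u) = SM.DP z u"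
    "norm (A u - SM.DP z u) \<le> c * norm u"
proof -
  have zi: "z \<in> M1" "z \<in> M2" using z M_eq by auto
  note P = SM.orthogonal_projector_DP[OF z(1,3)]
  note P1 = S1.orthogonal_projector_DP[OF zi(1) z(3)]
  note P2 = S2.orthogonal_projector_DP[OF zi(2) z(3)]
  have fixed: "S1.DP z (SM.DP z u) = SM.DP z u" "S2.DP z (SM.DP z u) = SM.DP z u" for u
    using SM.DP_tangent[OF z(1,3), of u] tangent[OF z(2)]
      S1.tangent_imp_DP_fixed[OF zi(1) z(3)] S2.tangent_imp_DP_fixed[OF zi(2) z(3)] by auto
  show "orthogonal_projector (SM.DP z)" by (rule P)
  show "A (SM.DP z u) = SM.DP z u" by (simp add: A fixed)
  have "SM.DP z (A u) \<bullet> w = SM.DP z u \<bullet> w" for w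
  proof -
    have "SM.DP z (A u) \<bullet> w = A u \<bullet> SM.DP z w" by (rule orthogonal_projectorD(3)[OF P])
    also have "\<dots> = S2.DP z u \<bullet> S1.DP z (SM.DP z w)"
      by (simp add: A orthogonal_projectorD(3)[OF P1])
    also have "\<dots> = u \<bullet> S2.DP z (SM.DP z w)"
      by (simp add: fixed(1) orthogonal_projectorD(3)[OF P2])
    also have "\<dots> = SM.DP z u \<bullet> w"
      by (simp add: fixed(2) orthogonal_projectorD(3)[OF P])
    finally show ?thesis .
  qed
  then show "SM.DP z (A u) = SM.DP z u" using vector_eq_rdot by blast
  have "bounded_linear (\<lambda>u. A u - SM.DP z u)"
    unfolding A
    by (rule bounded_linear_sub[OF bounded_linear_compose])
       (rule has_derivative_bounded_linear[OF S1.has_derivative_projection[OF z(3)]]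
         has_derivative_bounded_linear[OF S2.has_derivative_projection[OF z(3)]]
         has_derivative_bounded_linear[OF SM.has_derivative_projection[OF z(3)]])+
  from onorm[OF this, of u]
  have "norm (A u - SM.DP z u) \<le> onorm (\<lambda>u. A u - SM.DP z u) * norm u" .
  also have "\<dots> \<le> c * norm u"
    using angle[OF z(2)]
    by (intro mult_right_mono) (simp_all add: A S1.closest_point_tangent_space[OF zi(1) z(3)]
        S2.closest_point_tangent_space[OF zi(2) z(3)] SM.closest_point_tangent_space[OF z(1,3)])
  finally show "norm (A u - SM.DP z u) \<le> c * norm u" .
qed

lemma uniform_bounds:
  "\<exists>L\<ge>0. (\<forall>y. infdist y K \<le> \<delta> / 2 \<longrightarrow> norm (D1 y) \<le> L \<and> norm (D2 y) \<le> L) \<and>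
     L-lipschitz_on (neighborhood \<delta> K) D2"
proof -
  let ?C = "{y. infdist y K \<le> \<delta> / 2}"
  have C: "compact ?C" "?C \<subseteq> neighborhood \<delta> K"
    using compact_infdist_le[OF K(2,1), of "\<delta> / 2"] \<delta> by (auto simp: neighborhood_def)
  have "continuous_on (neighborhood \<delta> K) D1"
    using D2 has_derivative_continuous by (intro continuous_at_imp_continuous_on) blast
  from compact_imp_bounded[OF compact_continuous_image[OF continuous_on_subset[OF this C(2)] C(1)]]
  have "bounded (D1 ` ?C)" .
  then obtain L1 where L1: "\<And>y. y \<in> ?C \<Longrightarrow> norm (D1 y) \<le> L1" by (auto simp: bounded_iff)
  from compact_imp_bounded[OF compact_continuous_image[OF
      continuous_on_subset[OF lipschitz_on_continuous_on[OF D2_lipschitz] C(2)] C(1)]]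
  have "bounded (D2 ` ?C)" .
  then obtain L2 where L2: "\<And>y. y \<in> ?C \<Longrightarrow> norm (D2 y) \<le> L2" by (auto simp: bounded_iff)
  define L where "L = max \<Lambda> (max L1 L2)"
  have "0 \<le> L" using lipschitz_on_nonneg[OF D2_lipschitz] by (simp add: L_def)
  moreover have "L-lipschitz_on (neighborhood \<delta> K) D2"
    by (rule lipschitz_on_le[OF D2_lipschitz]) (simp add: L_def)
  moreover have "norm (D1 y) \<le> L" "norm (D2 y) \<le> L" if "infdist y K \<le> \<delta> / 2" for y
    using L1[of y] L2[of y] that by (simp_all add: L_def le_max_iff_disj)
  ultimately show ?thesis by blast
qed

text \<open>
  The radii and constants are uniform in \<open>x \<in> K\<close>: the radius \<open>\<epsilon>\<close> is a Lebesgue number of the cover of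
  \<open>K\<close> by the sets from \<open>local_structure\<close>, and \<open>L\<close> bounds the derivatives on a compact neighborhood of
  \<open>K\<close>.
\<close>

proposition attracting_fixed_set_near_K:
  "\<exists>r \<epsilon> L C c' \<theta>. 0 < r \<and> r \<le> \<epsilon> \<and>
     (\<forall>x\<in>K. attracting_fixed_set \<phi> \<Phi> D1 D2 SM.DP (ball x \<epsilon>) (M \<inter> ball x \<epsilon>) (ball x r) L C c' \<theta>)"
proof -
  define good where "good = (\<lambda>G. open G \<and> G \<subseteq> neighborhood \<delta> K \<and> M \<inter> G \<subseteq> W \<and> (\<forall>y\<in>G. \<phi> y \<in> M1) \<and>
    (\<forall>z\<in>M \<inter> G. \<phi> z = z) \<and> (\<forall>z\<in>M \<inter> G. \<forall>u. blinfun_apply (D1 z) u = S1.DP z (S2.DP z u)))"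
  have cover: "K \<subseteq> \<Union>{G. good G}"
  proof
    fix x assume "x \<in> K"
    then obtain G where "open G" "x \<in> G" "G \<subseteq> neighborhood \<delta> K" "M \<inter> G \<subseteq> W"
        "\<And>y. y \<in> G \<Longrightarrow> \<phi> y \<in> M1" "\<And>z. z \<in> M \<Longrightarrow> z \<in> G \<Longrightarrow> \<phi> z = z"
        "\<And>z u. z \<in> M \<Longrightarrow> z \<in> G \<Longrightarrow> blinfun_apply (D1 z) u = S1.DP z (S2.DP z u)"
      by (rule local_structure) blast
    then have "good G" "x \<in> G" by (simp_all add: good_def)
    then show "x \<in> \<Union>{G. good G}" by blast
  qed
  obtain e where e: "0 < e" "\<And>x. x \<in> K \<Longrightarrow> \<exists>G\<in>{G. good G}. ball x e \<subseteq> G"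
    by (rule Heine_Borel_lemma[OF K(1) cover]) (simp_all add: good_def)
  obtain L where L: "0 \<le> L" "\<And>y. infdist y K \<le> \<delta> / 2 \<Longrightarrow> norm (D1 y) \<le> L"
    "\<And>y. infdist y K \<le> \<delta> / 2 \<Longrightarrow> norm (D2 y) \<le> L" "L-lipschitz_on (neighborhood \<delta> K) D2"
    using uniform_bounds by blast
  define \<epsilon> where "\<epsilon> = min e (\<delta> / 2)"
  define X where "X = L + (L + 1) * \<kappa> * L / (1 - \<tau>)"
  \<comment> \<open>The orbit of a point of \<open>ball x r\<close> will be shown, from the first iterate on, to stay within \<open>r * X\<close> of \<open>x\<close>.\<close>
  define r where "r = (\<epsilon> / 4) / (X + 1)"
  \<comment> \<open>The maxima ensure \<open>0 \<le> c'\<close> and that \<open>\<theta>\<close> dominates both rates, \<open>\<tau>\<close> for orbits and \<open>c'\<close> for derivatives.\<close>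
  define c' where "c' = max c 0"
  define \<theta> where "\<theta> = max \<tau> ((1 + c') / 2)"
  have \<epsilon>: "0 < \<epsilon>" using e(1) \<delta> by (simp add: \<epsilon>_def)
  have X: "0 \<le> X" using L(1) \<kappa> \<tau> by (simp add: X_def)
  have r: "0 < r" using \<epsilon> X by (simp add: r_def)
  have "X + 1 \<noteq> 0" using X by simp
  then have "r * (X + 1) = \<epsilon> / 4" by (metis r_def nonzero_divide_eq_eq)
  then have rX: "r * X + r = \<epsilon> / 4" by (simp add: algebra_simps)
  have rX0: "0 \<le> r * X" using r X by simp
  have r4: "r \<le> \<epsilon> / 4" "r * X \<le> \<epsilon> / 4" using rX rX0 r by linarith+
  have r\<epsilon>: "r \<le> \<epsilon>" using r4 \<epsilon> by simp
  have const: "0 \<le> c'" "c' < \<theta>" "\<theta> < 1" "\<tau> \<le> \<theta>"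
  proof -
    have "0 \<le> c'" "c' < 1" using c1 by (simp_all add: c'_def)
    then show "0 \<le> c'" "c' < \<theta>" "\<theta> < 1" "\<tau> \<le> \<theta>"
      using \<tau> by (simp_all add: \<theta>_def less_max_iff_disj)
  qed
  have rX': "L * r + (L + 1) * \<kappa> * (L * r) / (1 - \<tau>) \<le> \<epsilon> / 4"
    using r4(2) by (simp add: X_def algebra_simps add_divide_distrib)
  have main: "attracting_fixed_set \<phi> \<Phi> D1 D2 SM.DP (ball x \<epsilon>) (M \<inter> ball x \<epsilon>) (ball x r) L (\<epsilon> / \<tau>) c' \<theta>" if x: "x \<in> K" for x
  proof -
    obtain G where G: "good G" "ball x e \<subseteq> G" using e(2)[OF x] by blast
    then have BG: "ball x \<epsilon> \<subseteq> G" by (auto simp: \<epsilon>_def)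
    have BN: "ball x \<epsilon> \<subseteq> neighborhood \<delta> K" using G BG by (auto simp: good_def)
    then have BU: "ball x \<epsilon> \<subseteq> U" using \<delta> by blast
    have near: "infdist y K \<le> \<delta> / 2" if "y \<in> ball x \<epsilon>" for y
      using infdist_le[OF x, of y] that by (simp add: \<epsilon>_def dist_commute)
    have inW: "z \<in> W" if "z \<in> M" "z \<in> ball x \<epsilon>" for z
      using G BG that by (auto simp: good_def)
    have fixed: "\<phi> z = z" if "z \<in> M" "z \<in> ball x \<epsilon>" for z
      using G BG that by (auto simp: good_def)
    have D1z: "blinfun_apply (D1 z) u = S1.DP z (S2.DP z u)" if "z \<in> M" "z \<in> ball x \<epsilon>" for z u
      using G(1) BG that unfolding good_def by blast
    have lip: "norm (\<phi> y - \<phi> y') \<le> L * norm (y - y')" if "y \<in> ball x \<epsilon>" "y' \<in> ball x \<epsilon>" for y y'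
    proof (rule differentiable_bound[OF convex_ball])
      show "(\<phi> has_derivative blinfun_apply (D1 u)) (at u within ball x \<epsilon>)" if "u \<in> ball x \<epsilon>" for u
        using D1 BN that has_derivative_at_withinI by blast
      show "onorm (blinfun_apply (D1 u)) \<le> L" if "u \<in> ball x \<epsilon>" for u
        using L(2)[OF near[OF that]] by (simp add: norm_blinfun.rep_eq)
    qed (use that in auto)
    have lip1: "L-lipschitz_on (ball x \<epsilon>) D1"
    proof (rule lipschitz_onI)
      fix y y' assume yy: "y \<in> ball x \<epsilon>" "y' \<in> ball x \<epsilon>"
      have "norm (D1 y - D1 y') \<le> L * norm (y - y')"
      proof (rule differentiable_bound[OF convex_ball])
        show "(D1 has_derivative blinfun_apply (D2 u)) (at u within ball x \<epsilon>)" if "u \<in> ball x \<epsilon>" for u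
          using D2 BN that has_derivative_at_withinI by blast
        show "onorm (blinfun_apply (D2 u)) \<le> L" if "u \<in> ball x \<epsilon>" for u
          using L(3)[OF near[OF that]] by (simp add: norm_blinfun.rep_eq)
      qed (use yy in auto)
      then show "dist (D1 y) (D1 y') \<le> L * dist y y'" by (simp add: dist_norm)
    qed (rule L(1))
    have xM: "x \<in> M" "M \<subseteq> M2" using x K M_eq by auto
    have orbit: "(\<phi> ^^ k) y \<in> ball x \<epsilon>"
      "\<exists>z\<in>M \<inter> ball x \<epsilon>. (\<lambda>k. (\<phi> ^^ k) y) \<longlonglongrightarrow> z \<and> (\<forall>k. norm ((\<phi> ^^ k) y - z) \<le> \<epsilon> / \<tau> * \<tau> ^ k)"
      if y: "y \<in> ball x r" for y k
    proof -
      have into: "\<phi> y \<in> M1" if "y \<in> ball x \<epsilon>" for y using G BG that by (auto simp: good_def)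
      have dec: "infdist (\<phi> y) M2 \<le> \<tau> * infdist y M2" if "y \<in> M1" "y \<in> ball x \<epsilon>" for y
        using decay that BN by blast
      have reg: "infdist y M \<le> \<kappa> * infdist y M2" if "y \<in> M1" "y \<in> ball x \<epsilon>" for y
        using \<kappa>(2) that BU by blast
      have nst: "\<exists>m\<in>M. dist y m = infdist y M" if "y \<in> ball x \<epsilon>" for y
        using projection_defined_onD(1)[OF SM.defined] dist_closest_point_eq_infdist[OF SM.defined]
          that BU by blast
      note * = orbit_converges[OF \<epsilon> L(1) less_imp_le[OF \<kappa>(1)] \<tau> r4(1) rX' xM lip fixed into dec reg nst y]
      show "(\<phi> ^^ k) y \<in> ball x \<epsilon>" by (rule *(1))
      show "\<exists>z\<in>M \<inter> ball x \<epsilon>. (\<lambda>k. (\<phi> ^^ k) y) \<longlonglongrightarrow> z \<and> (\<forall>k. norm ((\<phi> ^^ k) y - z) \<le> \<epsilon> / \<tau> * \<tau> ^ k)"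
        by (rule *(2))
    qed
    have lim: "\<Phi> y \<in> M \<inter> ball x \<epsilon> \<and> (\<forall>k. norm ((\<phi> ^^ k) y - \<Phi> y) \<le> \<epsilon> / \<tau> * \<tau> ^ k)"
      if y: "y \<in> ball x r" for y
    proof -
      obtain z where z: "z \<in> M \<inter> ball x \<epsilon>" "(\<lambda>k. (\<phi> ^^ k) y) \<longlonglongrightarrow> z"
          "\<forall>k. norm ((\<phi> ^^ k) y - z) \<le> \<epsilon> / \<tau> * \<tau> ^ k"
        using orbit(2)[OF y] by blast
      have "\<Phi> y = z" unfolding \<Phi>_def by (rule limI[OF z(2)])
      then show ?thesis using z by blast
    qed
    have zW: "z \<in> M" "z \<in> W" "z \<in> U" if "z \<in> M \<inter> ball x \<epsilon>" for z
      using that inW BU by auto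
    have PP: "orthogonal_projector (SM.DP z)" "blinfun_apply (D1 z) (SM.DP z u) = SM.DP z u"
      "SM.DP z (blinfun_apply (D1 z) u) = SM.DP z u"
      "norm (blinfun_apply (D1 z) u - SM.DP z u) \<le> c * norm u"
      if "z \<in> M \<inter> ball x \<epsilon>" for z u
      using projector_products[OF zW[OF that], where A = "blinfun_apply (D1 z)"] D1z that by auto
    show ?thesis
    proof (rule attracting_fixed_set.intro)
      show "0 \<le> L" "0 \<le> c'" "c' < \<theta>" "\<theta> < 1" by (fact L(1) const)+
      show "0 \<le> \<epsilon> / \<tau>" using \<epsilon> \<tau> by simp
      show "(\<phi> has_derivative blinfun_apply (D1 y)) (at y)" if "y \<in> ball x \<epsilon>" for y
        using D1 that BN by blast
      show "(D1 has_derivative blinfun_apply (D2 y)) (at y)" if "y \<in> ball x \<epsilon>" for y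
        using D2 that BN by blast
      show "norm (D1 y) \<le> L" "norm (D2 y) \<le> L" if "y \<in> ball x \<epsilon>" for y
        using L(2,3) near[OF that] by auto
      show "L-lipschitz_on (ball x \<epsilon>) D1" by (rule lip1)
      show "L-lipschitz_on (ball x \<epsilon>) D2" by (rule lipschitz_on_subset[OF L(4) BN])
      show "M \<inter> ball x \<epsilon> \<subseteq> ball x \<epsilon>" by blast
      show "open (ball x r)" "convex (ball x r)" by auto
      fix z u assume z: "z \<in> M \<inter> ball x \<epsilon>"
      show "\<phi> z = z" using z fixed by blast
      show "linear (SM.DP z)" "SM.DP z (SM.DP z u) = SM.DP z u" "norm (SM.DP z u) \<le> norm u"
        using orthogonal_projectorD[OF PP(1)[OF z]] norm_orthogonal_projector_le[OF PP(1)[OF z]] by auto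
      show "SM.DP z (blinfun_apply (D1 z) u) = SM.DP z u" by (rule PP(3)[OF z])
      show "blinfun_apply (D1 z) (SM.DP z u) = SM.DP z u" by (rule PP(2)[OF z])
      show "norm (blinfun_apply (D1 z) u - SM.DP z u) \<le> c' * norm u"
        by (rule order_trans[OF PP(4)[OF z]]) (simp add: c'_def mult_right_mono)
    next
      fix z a b assume z: "z \<in> M \<inter> ball x \<epsilon>" and ab: "SM.DP z a = a" "SM.DP z b = b"
      show "SM.DP z (blinfun_apply (blinfun_apply (D2 z) a) b) = 0"
      proof (rule SM.second_derivative_normal[OF open_ball BU _ _ _ _ _ ab])
        show "(D1 has_derivative blinfun_apply (D2 z)) (at z)" using D2 z BN by blast
      qed (use z PP in auto)
    next
      fix y k assume y: "y \<in> ball x r"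
      show "(\<phi> ^^ k) y \<in> ball x \<epsilon>" by (rule orbit(1)[OF y])
      show "\<Phi> y \<in> M \<inter> ball x \<epsilon>" using lim[OF y] by blast
      have "norm ((\<phi> ^^ k) y - \<Phi> y) \<le> \<epsilon> / \<tau> * \<tau> ^ k" using lim[OF y] by blast
      also have "\<dots> \<le> \<epsilon> / \<tau> * \<theta> ^ k"
        using \<epsilon> \<tau> const by (intro mult_left_mono power_mono) auto
      finally show "norm ((\<phi> ^^ k) y - \<Phi> y) \<le> \<epsilon> / \<tau> * \<theta> ^ k" .
    qed
  qed
  show ?thesis using r r\<epsilon> main by blast
qed

text \<open>
  On the domain, \<open>\<psi> (x, \<eta>) = \<Phi> (x + \<eta>)\<close>, where \<open>\<Phi>\<close> is defined on an open set of the ambient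
  space; this yields the local extensions of class \<open>C\<^sup>2\<close>. The tangential part of
  \<open>\<psi> (x, t \<eta>) - (x + t \<eta>)\<close> has vanishing first derivative at \<open>t = 0\<close>, and its second derivative
  there is \<open>P\<^sub>T (D\<^sup>2\<Phi>(x)[\<eta>, \<eta>])\<close>, which is zero by \<open>P_jet2_lim\<close>.
\<close>

proposition limit_map_second_order_retraction:
  assumes afs: "\<And>x. x \<in> K \<Longrightarrow>
      attracting_fixed_set \<phi> \<Phi> D1 D2 SM.DP (ball x \<epsilon>) (M \<inter> ball x \<epsilon>) (ball x r) L C c' \<theta>"
    and r: "0 < r" "r \<le> \<epsilon>" "\<rho> \<le> r" and KU: "K \<subseteq> U"
    and \<Omega>: "\<Omega> \<subseteq> K"
    and lim: "\<And>x \<eta>. (x, \<eta>) \<in> retraction_domain M \<Omega> \<rho> \<Longrightarrow> (\<lambda>k. (\<phi> ^^ k) (x + \<eta>)) \<longlonglongrightarrow> \<psi> (x, \<eta>)"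
    and first: "first_order_retraction M (retraction_domain M \<Omega> \<rho>) \<psi>"
  shows "second_order_retraction M (retraction_domain M \<Omega> \<rho>) \<psi>"
proof -
  let ?D = "retraction_domain M \<Omega> \<rho>"
  have \<psi>: "\<psi> (x, \<eta>) = \<Phi> (x + \<eta>)" if "(x, \<eta>) \<in> ?D" for x \<eta>
    using limI[OF lim[OF that]] by (simp add: \<Phi>_def)
  have D: "x \<in> \<Omega>" "x \<in> K" "x \<in> M" "\<eta> \<in> tangent_space M x" "norm \<eta> < \<rho>" "x + \<eta> \<in> ball x r"
    if "(x, \<eta>) \<in> ?D" for x \<eta>
    using that \<Omega> r K by (auto simp: retraction_domain_def tangent_bundle_def dist_norm)
  have smooth: "Ck_within 2 ?D \<psi>"
    unfolding Ck_within_def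
  proof
    fix p assume "p \<in> ?D"
    then obtain x \<eta> where p: "p = (x, \<eta>)" and xD: "(x, \<eta>) \<in> ?D" by (cases p) auto
    interpret A: attracting_fixed_set \<phi> \<Phi> D1 D2 SM.DP "ball x \<epsilon>" "M \<inter> ball x \<epsilon>" "ball x r" L C c' \<theta>
      by (rule afs[OF D(2)[OF xD]])
    let ?s = "\<lambda>q :: 'a \<times> 'a. fst q + snd q"
    let ?V = "?s -` ball x r"
    have s: "(?s has_derivative ?s) (at q)" for q
      by (auto intro!: derivative_eq_intros)
    have conts: "continuous_on T ?s" for T by (intro continuous_intros)
    have V: "open ?V"
      by (rule open_vimage[OF open_ball conts])
    have "Ck 2 ?V (\<lambda>q. \<Phi> (?s q))"
    proof (rule Ck_2I[OF V])
      fix q v w :: "'a \<times> 'a"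
      show "continuous_on ?V (\<lambda>q. A.jet2_lim (?s q) (?s v) (?s w))"
        by (rule continuous_on_compose2[OF A.continuous_jet2_lim conts]) auto
      assume "q \<in> ?V"
      then have q: "?s q \<in> ball x r" by simp
      show "((\<lambda>q. \<Phi> (?s q)) has_derivative (\<lambda>v. A.jet1_lim (?s q) (?s v))) (at q)"
        using diff_chain_at[OF s A.has_derivative_limit[OF q]] by (simp add: o_def)
      show "((\<lambda>q. A.jet1_lim (?s q) (?s v)) has_derivative (\<lambda>w. A.jet2_lim (?s q) (?s v) (?s w))) (at q)"
        using diff_chain_at[OF s A.has_derivative_jet1_lim[OF q]] by (simp add: o_def)
    qed
    moreover have "p \<in> ?V" using D(6)[OF xD] p by simp
    moreover have "\<forall>y\<in>?D \<inter> ?V. \<psi> y = \<Phi> (?s y)" using \<psi> by auto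
    ultimately show "\<exists>V g. open V \<and> p \<in> V \<and> Ck 2 V g \<and> (\<forall>y\<in>?D \<inter> V. \<psi> y = g y)"
      using V by blast
  qed
  have orders: "\<psi> (x, 0) = x \<and>
      (\<lambda>t::real. norm (\<psi> (x, t *\<^sub>R \<eta>) - (x + t *\<^sub>R \<eta>))) \<in> o[at 0](\<lambda>t. t) \<and>
      (\<lambda>t::real. norm (closest_point (tangent_space M x) (\<psi> (x, t *\<^sub>R \<eta>) - (x + t *\<^sub>R \<eta>))))
          \<in> o[at 0](\<lambda>t. t\<^sup>2)"
    if xD: "(x, \<eta>) \<in> ?D" for x \<eta>
  proof -
    interpret A: attracting_fixed_set \<phi> \<Phi> D1 D2 SM.DP "ball x \<epsilon>" "M \<inter> ball x \<epsilon>" "ball x r" L C c' \<theta>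
      by (rule afs[OF D(2)[OF xD]])
    have xM: "x \<in> M" "x \<in> U" using D[OF xD] KU by auto
    have xF: "x \<in> M \<inter> ball x \<epsilon>" "x \<in> ball x r" using xM r by auto
    let ?P = "SM.DP x"
    interpret P: linear ?P by (rule A.linear_P[OF xF(1)])
    have tan: "tangent_space M x = {v. ?P v = v}" by (rule SM.tangent_space_eq_DP_fixed[OF xM])
    have P\<eta>: "?P \<eta> = \<eta>" using D(4)[OF xD] tan by simp
    have \<psi>0: "\<psi> (x, 0) = x"
      and d\<psi>: "((\<lambda>t::real. \<psi> (x, t *\<^sub>R \<eta>)) has_vector_derivative \<eta>) (at 0)"
      using first xD by (auto simp: first_order_retraction_def)
    have order1: "(\<lambda>t::real. norm (\<psi> (x, t *\<^sub>R \<eta>) - (x + t *\<^sub>R \<eta>))) \<in> o[at 0](\<lambda>t. t)"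
      using smallo_linear_if_has_vector_derivative[OF d\<psi>] by (simp add: \<psi>0)
    have tD: "(x, t *\<^sub>R \<eta>) \<in> ?D" if t: "\<bar>t\<bar> < 1" for t
    proof -
      have "norm (t *\<^sub>R \<eta>) \<le> 1 * norm \<eta>" using t by (simp add: mult_left_le_one_le)
      then show ?thesis
        using D[OF xD] by (simp add: retraction_domain_def tangent_bundle_def tan P.scale P\<eta>)
    qed
    have dP: "(?P has_derivative ?P) (at y)" for y
      using A.linear_P[OF xF(1)] by (intro bounded_linear_imp_has_derivative) (simp add: linear_conv_bounded_linear)
    have line: "((\<lambda>t. x + t *\<^sub>R \<eta>) has_derivative (\<lambda>s. s *\<^sub>R \<eta>)) (at t)" for t
      by (auto intro!: derivative_eq_intros)
    define f where "f = (\<lambda>t. ?P (\<psi> (x, t *\<^sub>R \<eta>) - (x + t *\<^sub>R \<eta>)))"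
    define f1 where "f1 = (\<lambda>t. ?P (A.jet1_lim (x + t *\<^sub>R \<eta>) \<eta> - \<eta>))"
    have "(\<lambda>t. norm (f t)) \<in> o[at 0](\<lambda>t. t\<^sup>2)"
    proof (rule smallo_square_if_flat[of 1 _ f1])
      fix t :: real assume t: "\<bar>t\<bar> < 1"
      have y: "x + t *\<^sub>R \<eta> \<in> ball x r" by (rule D(6)[OF tD[OF t]])
      have "((\<lambda>t. \<Phi> (x + t *\<^sub>R \<eta>) - (x + t *\<^sub>R \<eta>)) has_derivative
          (\<lambda>s. A.jet1_lim (x + t *\<^sub>R \<eta>) (s *\<^sub>R \<eta>) - s *\<^sub>R \<eta>)) (at t)"
        using has_derivative_diff[OF diff_chain_at[OF line A.has_derivative_limit[OF y]] line]
        by (simp add: o_def)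
      from diff_chain_at[OF this dP]
      have "((\<lambda>t. ?P (\<Phi> (x + t *\<^sub>R \<eta>) - (x + t *\<^sub>R \<eta>))) has_derivative
          (\<lambda>s. ?P (A.jet1_lim (x + t *\<^sub>R \<eta>) (s *\<^sub>R \<eta>) - s *\<^sub>R \<eta>))) (at t)"
        by (simp add: o_def)
      moreover have "A.jet1_lim (x + t *\<^sub>R \<eta>) (s *\<^sub>R \<eta>) = s *\<^sub>R A.jet1_lim (x + t *\<^sub>R \<eta>) \<eta>" for s
        using A.has_derivative_limit[OF y] has_derivative_linear linear_scale by blast
      ultimately have dF: "((\<lambda>t. ?P (\<Phi> (x + t *\<^sub>R \<eta>) - (x + t *\<^sub>R \<eta>))) has_derivative
          (\<lambda>s. s *\<^sub>R f1 t)) (at t)"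
        by (simp add: f1_def P.scale flip: scaleR_diff_right)
      have "(f has_derivative (\<lambda>s. s *\<^sub>R f1 t)) (at t)"
      proof (rule differentiable_cong_open[OF _ _ _ dF])
        show "open {-1<..<1::real}" "t \<in> {-1<..<1}" using t by auto
        show "f s = ?P (\<Phi> (x + s *\<^sub>R \<eta>) - (x + s *\<^sub>R \<eta>))" if "s \<in> {-1<..<1}" for s
          using \<psi>[OF tD[of s]] that by (simp add: f_def abs_less_iff)
      qed
      then show "(f has_vector_derivative f1 t) (at t)"
        by (simp add: has_vector_derivative_def)
    next
      show "f 0 = 0" by (simp add: f_def \<psi>0 P.zero)
      show "f1 0 = 0" by (simp add: f1_def A.jet1_lim_fixed[OF xF(1) P\<eta>] P.zero)
      have "((\<lambda>y. A.jet1_lim y \<eta>) has_derivative A.jet2_lim x \<eta>) (at (x + 0 *\<^sub>R \<eta>))"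
        using A.has_derivative_jet1_lim[OF xF(2)] by simp
      from diff_chain_at[OF line this]
      have "((\<lambda>t. A.jet1_lim (x + t *\<^sub>R \<eta>) \<eta> - \<eta>) has_derivative
          (\<lambda>s. A.jet2_lim x \<eta> (s *\<^sub>R \<eta>) - 0)) (at 0)"
        by (intro has_derivative_diff has_derivative_const) (simp add: o_def)
      from diff_chain_at[OF this dP]
      have "(f1 has_derivative (\<lambda>s. ?P (A.jet2_lim x \<eta> (s *\<^sub>R \<eta>)))) (at 0)"
        by (simp add: o_def f1_def)
      moreover have "?P (A.jet2_lim x \<eta> (s *\<^sub>R \<eta>)) = 0" for s
        by (rule A.P_jet2_lim[OF xF P\<eta>]) (simp add: P.scale P\<eta>)
      ultimately show "(f1 has_vector_derivative 0) (at 0)"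
        by (simp add: has_vector_derivative_def)
    qed simp
    then have order2: "(\<lambda>t::real. norm (closest_point (tangent_space M x) (\<psi> (x, t *\<^sub>R \<eta>) - (x + t *\<^sub>R \<eta>))))
          \<in> o[at 0](\<lambda>t. t\<^sup>2)"
      by (simp add: f_def SM.closest_point_tangent_space[OF xM])
    show ?thesis using \<psi>0 order1 order2 by blast
  qed
  show ?thesis
    unfolding second_order_retraction_def
    using first smooth orders by (auto simp: first_order_retraction_def)
qed

end

lemma alternating_framework_pointwise:
  assumes "alternating_framework_at p M1 M2 \<phi>1 \<phi>2 x" "p - 1 = Suc k"
  shows "\<exists>V. open V \<and> x \<in> V \<and> (\<forall>y\<in>V. isCont \<phi>1 y) \<and> (\<forall>y\<in>V. isCont \<phi>2 y) \<and> \<phi>1 ` V \<subseteq> M1 \<and>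
      ((\<forall>y\<in>V. \<phi>1 y = closest_point M1 y) \<or> first_order_consistent V \<phi>1 M1) \<and>
      ((\<forall>y\<in>V. \<phi>2 y = closest_point M2 y) \<or> first_order_consistent V \<phi>2 M2)"
proof -
  obtain V where V: "open V" "x \<in> V" "Ck (Suc k) V \<phi>1" "Ck (Suc k) V \<phi>2" "\<phi>1 ` V \<subseteq> M1"
    "(\<forall>y\<in>V. \<phi>1 y = closest_point M1 y) \<and> first_order_consistent V \<phi>2 M2 \<or>
         (\<forall>y\<in>V. \<phi>2 y = closest_point M2 y) \<and> first_order_consistent V \<phi>1 M1 \<or>
         first_order_consistent V \<phi>1 M1 \<and> first_order_consistent V \<phi>2 M2"
    using assms(1) unfolding alternating_framework_at_def assms(2) by blast
  then show ?thesis
    using Ck_isCont[OF V(3)] Ck_isCont[OF V(4)] by (intro exI[of _ V]) blast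
qed


section \<open>The limit map is a second-order retraction\<close>

theorem theorem3:
  fixes p :: nat
    and M1 M2 M W U \<Omega> K :: "'a::euclidean_space set"
    and xbar :: 'a
    and \<phi>1 \<phi>2 :: "'a \<Rightarrow> 'a"
    and \<delta>\<^sub>K \<tau>\<^sub>K \<rho>\<^sub>0 C\<^sub>K :: real
  assumes "3 \<le> p"
    and "embedded_submanifold p M1" and "embedded_submanifold p M2"
    and "M = M1 \<inter> M2" and "xbar \<in> M"
    and "local_sets p M1 M2 \<phi>1 \<phi>2 xbar W U \<Omega> K"
    and "admissible_radius M1 M2 \<phi>1 \<phi>2 U \<Omega> K \<delta>\<^sub>K \<tau>\<^sub>K \<rho>\<^sub>0 C\<^sub>K"
    and "\<forall>x\<in>K. clean_intersection_at p M1 M2 x"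
    and "\<forall>x\<in>K. alternating_framework_at p M1 M2 \<phi>1 \<phi>2 x"
    and "decomposition_property p M1 M2 \<phi>1 \<phi>2 U K \<delta>\<^sub>K"
  shows "\<exists>\<rho>\<^sub>1. 0 < \<rho>\<^sub>1 \<and> \<rho>\<^sub>1 \<le> \<rho>\<^sub>0 \<and>
    (\<forall>\<rho>\<^sub>K \<psi>. 0 < \<rho>\<^sub>K \<and> \<rho>\<^sub>K \<le> \<rho>\<^sub>1 \<and>
       (\<forall>(x, \<eta>)\<in>retraction_domain M \<Omega> \<rho>\<^sub>K.
          iterates_defined U \<phi>1 \<phi>2 (x + \<eta>) \<and>
          (\<lambda>k. ((\<phi>1 \<circ> \<phi>2) ^^ k) (x + \<eta>)) \<longlonglongrightarrow> \<psi> (x, \<eta>)) \<and>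
       first_order_retraction M (retraction_domain M \<Omega> \<rho>\<^sub>K) \<psi> \<longrightarrow>
       second_order_retraction M (retraction_domain M \<Omega> \<rho>\<^sub>K) \<psi>)"
proof -
  define q where "q = p - 3"
  have p: "p - 1 = Suc (Suc q)" using \<open>3 \<le> p\<close> by (simp add: q_def)
  have M: "M = M1 \<inter> M2" by fact
  note loc = \<open>local_sets p M1 M2 \<phi>1 \<phi>2 xbar W U \<Omega> K\<close>[unfolded local_sets_def Let_def p, folded M]
  have "open U" and W: "openin (top_of_set M) W" and "xbar \<in> \<Omega>"
    and tangent: "\<And>x. x \<in> W \<Longrightarrow> tangent_space M x = tangent_space M1 x \<inter> tangent_space M2 x"
    and proj: "\<forall>D\<in>{M1, M2, M}. projection_defined_on U D \<and> Ck1 (Suc (Suc q)) U (closest_point D)"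
    and \<Omega>: "openin (top_of_set M) \<Omega>"
    and K: "K = (top_of_set M) closure_of \<Omega>" "compact K" "K \<subseteq> W \<inter> U"
    using loc by blast+
  obtain c where c: "c < 1" "\<And>x. x \<in> W \<Longrightarrow>
      onorm (\<lambda>u. closest_point (tangent_space M1 x) (closest_point (tangent_space M2 x) u)
                        - closest_point (tangent_space M x) u) \<le> c"
    using loc by blast
  obtain \<kappa> where \<kappa>: "0 < \<kappa>" "\<And>x. x \<in> M1 \<Longrightarrow> x \<in> U \<Longrightarrow> infdist x M \<le> \<kappa> * infdist x M2"
    using loc by blast
  note adm = \<open>admissible_radius M1 M2 \<phi>1 \<phi>2 U \<Omega> K \<delta>\<^sub>K \<tau>\<^sub>K \<rho>\<^sub>0 C\<^sub>K\<close>[unfolded admissible_radius_def]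
  have \<delta>: "0 < \<delta>\<^sub>K" "neighborhood \<delta>\<^sub>K K \<subseteq> U" and \<tau>: "0 < \<tau>\<^sub>K" "\<tau>\<^sub>K < 1" and \<rho>0: "0 < \<rho>\<^sub>0"
    and decay: "\<And>y. y \<in> M1 \<Longrightarrow> y \<in> neighborhood \<delta>\<^sub>K K \<Longrightarrow>
        infdist ((\<phi>1 \<circ> \<phi>2) y) M2 \<le> \<tau>\<^sub>K * infdist y M2"
    using adm by blast+
  obtain D1 :: "'a \<Rightarrow> 'a \<Rightarrow>\<^sub>L 'a" and D2 :: "'a \<Rightarrow> 'a \<Rightarrow>\<^sub>L 'a \<Rightarrow>\<^sub>L 'a" and \<Lambda> where
    D: "\<And>y. y \<in> neighborhood \<delta>\<^sub>K K \<Longrightarrow> ((\<phi>1 \<circ> \<phi>2) has_derivative blinfun_apply (D1 y)) (at y)"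
       "\<And>y. y \<in> neighborhood \<delta>\<^sub>K K \<Longrightarrow> (D1 has_derivative blinfun_apply (D2 y)) (at y)"
       "\<Lambda>-lipschitz_on (neighborhood \<delta>\<^sub>K K) D2"
    using \<open>decomposition_property p M1 M2 \<phi>1 \<phi>2 U K \<delta>\<^sub>K\<close>
    unfolding decomposition_property_def lipschitz_second_derivative_on_def by blast
  have \<Omega>K: "\<Omega> \<subseteq> K"
    using closure_of_subset[of \<Omega> "top_of_set M"] openin_subset[OF \<Omega>] K(1) by simp
  have KU: "K \<subseteq> U" using K(3) by blast
  have WM: "W \<subseteq> M" using openin_subset[OF W] by simp
  have S: "smooth_projection U D q" if "D \<in> {M1, M2, M}" for D
    using \<open>open U\<close> proj that by (auto simp: smooth_projection_def)
  interpret alternating_setting U M1 M2 M q W K \<phi>1 \<phi>2 \<delta>\<^sub>K \<tau>\<^sub>K \<kappa> c \<Lambda> D1 D2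
  proof (intro alternating_setting.intro alternating_setting_axioms.intro)
    show "smooth_projection U M1 q" "smooth_projection U M2 q" "smooth_projection U M q"
      using S by simp_all
    show "K \<noteq> {}" "K \<subseteq> W" "K \<subseteq> M" using \<open>xbar \<in> \<Omega>\<close> \<Omega>K K(3) WM by auto
    show "\<exists>V. open V \<and> x \<in> V \<and> (\<forall>y\<in>V. isCont \<phi>1 y) \<and> (\<forall>y\<in>V. isCont \<phi>2 y) \<and> \<phi>1 ` V \<subseteq> M1 \<and>
        ((\<forall>y\<in>V. \<phi>1 y = closest_point M1 y) \<or> first_order_consistent V \<phi>1 M1) \<and>
        ((\<forall>y\<in>V. \<phi>2 y = closest_point M2 y) \<or> first_order_consistent V \<phi>2 M2)" if "x \<in> K" for x
      using that \<open>\<forall>x\<in>K. alternating_framework_at p M1 M2 \<phi>1 \<phi>2 x\<close>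
      by (intro alternating_framework_pointwise[OF _ p]) blast
    show "M = M1 \<inter> M2" "openin (top_of_set M) W" "c < 1" "0 < \<kappa>" "compact K"
      "0 < \<delta>\<^sub>K" "neighborhood \<delta>\<^sub>K K \<subseteq> U" "0 < \<tau>\<^sub>K" "\<tau>\<^sub>K < 1"
      "\<Lambda>-lipschitz_on (neighborhood \<delta>\<^sub>K K) D2"
      by (fact M W c(1) \<kappa>(1) K(2) \<delta> \<tau> D(3))+
    fix x
    show "tangent_space M x = tangent_space M1 x \<inter> tangent_space M2 x" if "x \<in> W"
      by (rule tangent[OF that])
    show "onorm (\<lambda>u. closest_point (tangent_space M1 x) (closest_point (tangent_space M2 x) u)
        - closest_point (tangent_space M x) u) \<le> c" if "x \<in> W"
      by (rule c(2)[OF that])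
    show "infdist x M \<le> \<kappa> * infdist x M2" if "x \<in> M1" "x \<in> U"
      by (rule \<kappa>(2)[OF that])
    show "infdist ((\<phi>1 \<circ> \<phi>2) x) M2 \<le> \<tau>\<^sub>K * infdist x M2" if "x \<in> M1" "x \<in> neighborhood \<delta>\<^sub>K K"
      by (rule decay[OF that])
    show "((\<phi>1 \<circ> \<phi>2) has_derivative blinfun_apply (D1 x)) (at x)" if "x \<in> neighborhood \<delta>\<^sub>K K"
      by (rule D(1)[OF that])
    show "(D1 has_derivative blinfun_apply (D2 x)) (at x)" if "x \<in> neighborhood \<delta>\<^sub>K K"
      by (rule D(2)[OF that])
  qed
  obtain r \<epsilon> L C c' \<theta> where r: "0 < r" "r \<le> \<epsilon>"
    "\<And>x. x \<in> K \<Longrightarrow> attracting_fixed_set (\<phi>1 \<circ> \<phi>2) \<Phi> D1 D2 SM.DP (ball x \<epsilon>) (M \<inter> ball x \<epsilon>) (ball x r) L C c' \<theta>"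
    using attracting_fixed_set_near_K by blast
  show ?thesis
  proof (intro exI[of _ "min \<rho>\<^sub>0 r"] conjI allI impI)
    show "0 < min \<rho>\<^sub>0 r" "min \<rho>\<^sub>0 r \<le> \<rho>\<^sub>0" using \<rho>0 r(1) by auto
    fix \<rho>\<^sub>K \<psi>
    assume *: "0 < \<rho>\<^sub>K \<and> \<rho>\<^sub>K \<le> min \<rho>\<^sub>0 r \<and>
       (\<forall>(x, \<eta>)\<in>retraction_domain M \<Omega> \<rho>\<^sub>K.
          iterates_defined U \<phi>1 \<phi>2 (x + \<eta>) \<and>
          (\<lambda>k. ((\<phi>1 \<circ> \<phi>2) ^^ k) (x + \<eta>)) \<longlonglongrightarrow> \<psi> (x, \<eta>)) \<and>
       first_order_retraction M (retraction_domain M \<Omega> \<rho>\<^sub>K) \<psi>"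
    show "second_order_retraction M (retraction_domain M \<Omega> \<rho>\<^sub>K) \<psi>"
    proof (rule limit_map_second_order_retraction[OF r(3,1,2) _ _ \<Omega>K])
      show "\<rho>\<^sub>K \<le> r" "K \<subseteq> U" using * KU by auto
    qed (use * in auto)
  qed
qed

end
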